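(* Let $\Gamma\cup\{\varphi\}$ be a set of formulas in the language $\mathcal{L}=\{\wedge,\vee,\cdot,\to,0,1\}$. Then: (1) $\{\psi\approx 1 : \psi\in\Gamma\}\models_{\mathsf{GBL}} \varphi\approx 1$ if and only if $\{M(\psi)\approx 1 : \psi\in\Gamma\}\models_{\mathsf{S4MV}} M(\varphi)\approx 1$. (2) $\Gamma\vdash_{\mathbf{GBL}} \varphi$ if and only if $M(\Gamma)\vdash_{\mathbf{S4Ł}} M(\varphi)$. (3) $\{\psi\approx 1 : \psi\in\Gamma\}\models_{\mathsf{GBL}} \varphi\approx 1$ if and only if $\{T(\psi)\approx 1 : \psi\in\Gamma\}\models_{\mathsf{S4_tMV}} T(\varphi)\approx 1$. (4) $\Gamma\vdash_{\mathbf{GBL}} \varphi$ if and only if $T(\Gamma)\vdash_{\mathbf{S4_tŁ}} T(\varphi)$.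
   Context: Logics. Fix a countably infinite set of propositional variables. $\mathcal{L}$ has binary connectives $\wedge,\vee,\cdot,\to$ and constants $0,1$; for a set $I$ of unary connective symbols disjoint from $\mathcal{L}$, $\mathcal{L}(I)=\mathcal{L}\cup I$. Write $\varphi\leftrightarrow\psi$ for $(\varphi\to\psi)\wedge(\psi\to\varphi)$ and $\neg\varphi$ for $\varphi\to 0$. Axiom schemes: (A1) $\varphi\to\varphi$; (A2) $(\varphi\to\psi)\to((\psi\to\chi)\to(\varphi\to\chi))$; (A3) $(\varphi\cdot\psi)\to(\psi\cdot\varphi)$; (A4) $(\varphi\cdot\psi)\to\psi$; (A5) $(\varphi\to(\psi\to\chi))\to((\varphi\cdot\psi)\to\chi)$; (A6) $((\varphi\cdot\psi)\to\chi)\to(\varphi\to(\psi\to\chi))$; (A7) $(\varphi\cdot(\varphi\to\psi))\to(\varphi\wedge\psi)$; (A8) $(\varphi\wedge\psi)\to(\varphi\cdot(\varphi\to\psi))$; (A9) $(\varphi\wedge\psi)\to(\psi\wedge\varphi)$; (A10) $\varphi\to(\varphi\vee\psi)$; (A11) $\psi\to(\varphi\vee\psi)$; (A12) $((\varphi\to\psi)\wedge(\chi\to\psi))\to((\varphi\vee\chi)\to\psi)$; (A13) $0\to\varphi$; (A14) $(\varphi\to\psi)\vee(\psi\to\varphi)$; (A15) $\neg\neg\varphi\leftrightarrow\varphi$; and for a unary connective $\Box$: (K$_\Box$) $\Box(\varphi\to\psi)\to(\Box\varphi\to\Box\psi)$; (P$_\Box$) $\Box(\varphi\cdot\psi)\leftrightarrow\Box\varphi\cdot\Box\psi$;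 (M$_\Box$) $\Box(\varphi\wedge\psi)\leftrightarrow\Box\varphi\wedge\Box\psi$; (1$_\Box$) $\Box1\leftrightarrow1$; (0$_\Box$) $\Box0\leftrightarrow0$; (T$_\Box$) $\Box\varphi\to\varphi$; (4$_\Box$) $\Box\varphi\to\Box\Box\varphi$; and (GP) $\varphi\to G\neg H\neg\varphi$; (HF) $\varphi\to H\neg G\neg\varphi$. Rules: (MP) $\varphi,\varphi\to\psi\vdash\psi$; ($\Box$-Nec) $\varphi\vdash\Box\varphi$. $\mathbf{GBL}$ is the logic over $\mathcal{L}$ given by (A1)–(A13) and (MP). $\mathbf{Ł}(I)$ is the logic over $\mathcal{L}(I)$ with (A1)–(A15), and (K$_\Box$),(P$_\Box$),(M$_\Box$),(1$_\Box$),(0$_\Box$) and the rule ($\Box$-Nec) for every $\Box\in I$, plus (MP). $\mathbf{S4Ł}(I)$ adds (T$_\Box$),(4$_\Box$) for all $\Box\in I$; $\mathbf{S4Ł}=\mathbf{S4Ł}(\{\Box\})$; $\mathbf{S4_tŁ}$ is $\mathbf{S4Ł}(\{G,H\})$ plus (GP) and (HF). $\vdash_{\mathbf L}$ is the consequence relation of $\mathbf L$. Algebras. A GBL-algebra is a bounded commutative integral residuated lattice $(A,\wedge,\vee,\cdot,\to,0,1)$ satisfying $x(x\to y)\approx x\wedge y$; an MV-algebra is a GBL-algebra satisfying $(x\to y)\vee(y\to x)\approx1$ and $\neg\neg x\approx x$. An S4MV-algebra is an MV-algebra with a unary operation $\Box$ that is a $\{\wedge,\cdot,0,1\}$-endomorphism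 and an interior operator. An S4$_t$MV-algebra is an MV-algebra with two unary operations $G,H$, each a $\{\wedge,\cdot,0,1\}$-endomorphism and interior operator, such that $P(x)=\neg H(\neg x)$ satisfies $x\le G(y)\iff P(x)\le y$. $\mathsf{GBL},\mathsf{S4MV},\mathsf{S4_tMV}$ are the corresponding classes. For a class $\mathsf K$, $\Theta\models_{\mathsf K}\epsilon\approx\delta$ means every assignment into every member of $\mathsf K$ satisfying all equations of $\Theta$ satisfies $\epsilon\approx\delta$. Translations. $M$ maps $\mathcal{L}$-formulas to $\mathcal{L}(\{\Box\})$-formulas: $M(p)=\Box p$ for variables $p$, $M(0)=0$, $M(1)=1$, $M(\varphi\star\psi)=M(\varphi)\star M(\psi)$ for $\star\in\{\wedge,\vee,\cdot\}$, $M(\varphi\to\psi)=\Box(M(\varphi)\to M(\psi))$; $M(\Gamma)=\{M(\varphi):\varphi\in\Gamma\}$. $T$ is defined identically with $G$ in place of $\Box$, into $\mathcal{L}(\{G,H\})$-formulas.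
   Formalization: The constant 1 is added as an axiom to all three logics: the listed schemes do not prove 1, and (4) then fails for Γ={1→1·1}, φ=1∨(1→0). The classes GBL, S4MV, S4_tMV are taken over arbitrary infinite universes for the carriers, which give the same consequence relations. *)

theory Defs
  imports "HOL-Algebra.Group"
begin

section \<open>Formulas\<close>

datatype fm =
    Var nat
  | Zero
  | One
  | Conj fm fm
  | Disj fm fm
  | Fus fm fm
  | Imp fm fm

text \<open>The set of unary connectives that is added to the base language is the set of all
  elements of the type \<open>'i\<close>. As no HOL type is empty, the base language needs the
  separate type \<open>fm\<close>.\<close>

datatype 'i mfm =
    MVar nat
  | MZero
  | MOne
  | MConj "'i mfm" "'i mfm"
  | MDisj "'i mfm" "'i mfm"
  | MFus "'i mfm" "'i mfm"
  | MImp "'i mfm" "'i mfm"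
  | Modal 'i "'i mfm"

datatype box = Box

datatype tense = G_op | H_op

primrec translate :: "'i \<Rightarrow> fm \<Rightarrow> 'i mfm" where
  "translate b (Var p) = Modal b (MVar p)"
| "translate b Zero = MZero"
| "translate b One = MOne"
| "translate b (Conj \<phi> \<psi>) = MConj (translate b \<phi>) (translate b \<psi>)"
| "translate b (Disj \<phi> \<psi>) = MDisj (translate b \<phi>) (translate b \<psi>)"
| "translate b (Fus \<phi> \<psi>) = MFus (translate b \<phi>) (translate b \<psi>)"
| "translate b (Imp \<phi> \<psi>) = Modal b (MImp (translate b \<phi>) (translate b \<psi>))"

definition transM :: "fm \<Rightarrow> box mfm" where
  "transM = translate Box"

definition transT :: "fm \<Rightarrow> tense mfm" where
  "transT = translate G_op"


section \<open>Logics\<close>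

text \<open>Apart from clause \<open>One\<close>, no axiom scheme of GBL mentions the constant 1. Without
  this clause in both axiom sets, 1 would behave as one more variable in GBL, but as an element
  fixed by G and H in the tense logic, and the translation would not be faithful: from
  \<open>1 \<rightarrow> 1 \<cdot> 1\<close> the formula \<open>1 \<or> (1 \<rightarrow> 0)\<close> would not follow in GBL, whereas
  its translation would follow in the tense logic.\<close>

notation
  Zero ("\<^bold>0") and
  One ("\<^bold>1") and
  Conj (infixr "\<^bold>\<and>" 55) and
  Disj (infixr "\<^bold>\<or>" 53) and
  Fus (infixr "\<^bold>\<cdot>" 57) and
  Imp (infixr "\<^bold>\<rightarrow>" 50)

inductive_set gbl_axioms :: "fm set" where
  One: "\<^bold>1 \<in> gbl_axioms"
| A1: "(\<phi> \<^bold>\<rightarrow> \<phi>) \<in> gbl_axioms"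
| A2: "((\<phi> \<^bold>\<rightarrow> \<psi>) \<^bold>\<rightarrow> ((\<psi> \<^bold>\<rightarrow> \<chi>) \<^bold>\<rightarrow> (\<phi> \<^bold>\<rightarrow> \<chi>))) \<in> gbl_axioms"
| A3: "((\<phi> \<^bold>\<cdot> \<psi>) \<^bold>\<rightarrow> (\<psi> \<^bold>\<cdot> \<phi>)) \<in> gbl_axioms"
| A4: "((\<phi> \<^bold>\<cdot> \<psi>) \<^bold>\<rightarrow> \<psi>) \<in> gbl_axioms"
| A5: "((\<phi> \<^bold>\<rightarrow> (\<psi> \<^bold>\<rightarrow> \<chi>)) \<^bold>\<rightarrow> ((\<phi> \<^bold>\<cdot> \<psi>) \<^bold>\<rightarrow> \<chi>)) \<in> gbl_axioms"
| A6: "(((\<phi> \<^bold>\<cdot> \<psi>) \<^bold>\<rightarrow> \<chi>) \<^bold>\<rightarrow> (\<phi> \<^bold>\<rightarrow> (\<psi> \<^bold>\<rightarrow> \<chi>))) \<in> gbl_axioms"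
| A7: "((\<phi> \<^bold>\<cdot> (\<phi> \<^bold>\<rightarrow> \<psi>)) \<^bold>\<rightarrow> (\<phi> \<^bold>\<and> \<psi>)) \<in> gbl_axioms"
| A8: "((\<phi> \<^bold>\<and> \<psi>) \<^bold>\<rightarrow> (\<phi> \<^bold>\<cdot> (\<phi> \<^bold>\<rightarrow> \<psi>))) \<in> gbl_axioms"
| A9: "((\<phi> \<^bold>\<and> \<psi>) \<^bold>\<rightarrow> (\<psi> \<^bold>\<and> \<phi>)) \<in> gbl_axioms"
| A10: "(\<phi> \<^bold>\<rightarrow> (\<phi> \<^bold>\<or> \<psi>)) \<in> gbl_axioms"
| A11: "(\<psi> \<^bold>\<rightarrow> (\<phi> \<^bold>\<or> \<psi>)) \<in> gbl_axioms"
| A12: "(((\<phi> \<^bold>\<rightarrow> \<psi>) \<^bold>\<and> (\<chi> \<^bold>\<rightarrow> \<psi>)) \<^bold>\<rightarrow> ((\<phi> \<^bold>\<or> \<chi>) \<^bold>\<rightarrow> \<psi>)) \<in> gbl_axioms"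
| A13: "(\<^bold>0 \<^bold>\<rightarrow> \<phi>) \<in> gbl_axioms"

inductive gbl_derives :: "fm set \<Rightarrow> fm \<Rightarrow> bool" (infix "\<turnstile>\<^sub>G\<^sub>B\<^sub>L" 45) for \<Gamma> where
  axiom: "\<phi> \<in> gbl_axioms \<Longrightarrow> \<Gamma> \<turnstile>\<^sub>G\<^sub>B\<^sub>L \<phi>"
| premise: "\<phi> \<in> \<Gamma> \<Longrightarrow> \<Gamma> \<turnstile>\<^sub>G\<^sub>B\<^sub>L \<phi>"
| MP: "\<Gamma> \<turnstile>\<^sub>G\<^sub>B\<^sub>L \<phi> \<Longrightarrow> \<Gamma> \<turnstile>\<^sub>G\<^sub>B\<^sub>L (\<phi> \<^bold>\<rightarrow> \<psi>) \<Longrightarrow> \<Gamma> \<turnstile>\<^sub>G\<^sub>B\<^sub>L \<psi>"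

no_notation
  Zero ("\<^bold>0") and
  One ("\<^bold>1") and
  Conj (infixr "\<^bold>\<and>" 55) and
  Disj (infixr "\<^bold>\<or>" 53) and
  Fus (infixr "\<^bold>\<cdot>" 57) and
  Imp (infixr "\<^bold>\<rightarrow>" 50)

notation
  MZero ("\<^bold>0") and
  MOne ("\<^bold>1") and
  MConj (infixr "\<^bold>\<and>" 55) and
  MDisj (infixr "\<^bold>\<or>" 53) and
  MFus (infixr "\<^bold>\<cdot>" 57) and
  MImp (infixr "\<^bold>\<rightarrow>" 50)

abbreviation MNeg :: "'i mfm \<Rightarrow> 'i mfm" ("\<^bold>\<not> _" [60] 60) where
  "\<^bold>\<not> \<phi> \<equiv> \<phi> \<^bold>\<rightarrow> \<^bold>0"

abbreviation MIff :: "'i mfm \<Rightarrow> 'i mfm \<Rightarrow> 'i mfm" (infix "\<^bold>\<leftrightarrow>" 49) where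
  "\<phi> \<^bold>\<leftrightarrow> \<psi> \<equiv> (\<phi> \<^bold>\<rightarrow> \<psi>) \<^bold>\<and> (\<psi> \<^bold>\<rightarrow> \<phi>)"

inductive_set luk_axioms :: "'i mfm set" where
  One: "\<^bold>1 \<in> luk_axioms"
| A1: "(\<phi> \<^bold>\<rightarrow> \<phi>) \<in> luk_axioms"
| A2: "((\<phi> \<^bold>\<rightarrow> \<psi>) \<^bold>\<rightarrow> ((\<psi> \<^bold>\<rightarrow> \<chi>) \<^bold>\<rightarrow> (\<phi> \<^bold>\<rightarrow> \<chi>))) \<in> luk_axioms"
| A3: "((\<phi> \<^bold>\<cdot> \<psi>) \<^bold>\<rightarrow> (\<psi> \<^bold>\<cdot> \<phi>)) \<in> luk_axioms"
| A4: "((\<phi> \<^bold>\<cdot> \<psi>) \<^bold>\<rightarrow> \<psi>) \<in> luk_axioms"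
| A5: "((\<phi> \<^bold>\<rightarrow> (\<psi> \<^bold>\<rightarrow> \<chi>)) \<^bold>\<rightarrow> ((\<phi> \<^bold>\<cdot> \<psi>) \<^bold>\<rightarrow> \<chi>)) \<in> luk_axioms"
| A6: "(((\<phi> \<^bold>\<cdot> \<psi>) \<^bold>\<rightarrow> \<chi>) \<^bold>\<rightarrow> (\<phi> \<^bold>\<rightarrow> (\<psi> \<^bold>\<rightarrow> \<chi>))) \<in> luk_axioms"
| A7: "((\<phi> \<^bold>\<cdot> (\<phi> \<^bold>\<rightarrow> \<psi>)) \<^bold>\<rightarrow> (\<phi> \<^bold>\<and> \<psi>)) \<in> luk_axioms"
| A8: "((\<phi> \<^bold>\<and> \<psi>) \<^bold>\<rightarrow> (\<phi> \<^bold>\<cdot> (\<phi> \<^bold>\<rightarrow> \<psi>))) \<in> luk_axioms"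
| A9: "((\<phi> \<^bold>\<and> \<psi>) \<^bold>\<rightarrow> (\<psi> \<^bold>\<and> \<phi>)) \<in> luk_axioms"
| A10: "(\<phi> \<^bold>\<rightarrow> (\<phi> \<^bold>\<or> \<psi>)) \<in> luk_axioms"
| A11: "(\<psi> \<^bold>\<rightarrow> (\<phi> \<^bold>\<or> \<psi>)) \<in> luk_axioms"
| A12: "(((\<phi> \<^bold>\<rightarrow> \<psi>) \<^bold>\<and> (\<chi> \<^bold>\<rightarrow> \<psi>)) \<^bold>\<rightarrow> ((\<phi> \<^bold>\<or> \<chi>) \<^bold>\<rightarrow> \<psi>)) \<in> luk_axioms"
| A13: "(\<^bold>0 \<^bold>\<rightarrow> \<phi>) \<in> luk_axioms"
| A14: "((\<phi> \<^bold>\<rightarrow> \<psi>) \<^bold>\<or> (\<psi> \<^bold>\<rightarrow> \<phi>)) \<in> luk_axioms"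
| A15: "(\<^bold>\<not> \<^bold>\<not> \<phi> \<^bold>\<leftrightarrow> \<phi>) \<in> luk_axioms"
| K: "(Modal b (\<phi> \<^bold>\<rightarrow> \<psi>) \<^bold>\<rightarrow> (Modal b \<phi> \<^bold>\<rightarrow> Modal b \<psi>)) \<in> luk_axioms"
| P: "(Modal b (\<phi> \<^bold>\<cdot> \<psi>) \<^bold>\<leftrightarrow> (Modal b \<phi> \<^bold>\<cdot> Modal b \<psi>)) \<in> luk_axioms"
| M: "(Modal b (\<phi> \<^bold>\<and> \<psi>) \<^bold>\<leftrightarrow> (Modal b \<phi> \<^bold>\<and> Modal b \<psi>)) \<in> luk_axioms"
| Modal_one: "(Modal b \<^bold>1 \<^bold>\<leftrightarrow> \<^bold>1) \<in> luk_axioms"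
| Modal_zero: "(Modal b \<^bold>0 \<^bold>\<leftrightarrow> \<^bold>0) \<in> luk_axioms"

inductive_set s4luk_axioms :: "'i mfm set" where
  luk: "\<phi> \<in> luk_axioms \<Longrightarrow> \<phi> \<in> s4luk_axioms"
| T: "(Modal b \<phi> \<^bold>\<rightarrow> \<phi>) \<in> s4luk_axioms"
| Four: "(Modal b \<phi> \<^bold>\<rightarrow> Modal b (Modal b \<phi>)) \<in> s4luk_axioms"

inductive_set s4tluk_axioms :: "tense mfm set" where
  s4luk: "\<phi> \<in> s4luk_axioms \<Longrightarrow> \<phi> \<in> s4tluk_axioms"
| GP: "(\<phi> \<^bold>\<rightarrow> Modal G_op (\<^bold>\<not> (Modal H_op (\<^bold>\<not> \<phi>)))) \<in> s4tluk_axioms"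
| HF: "(\<phi> \<^bold>\<rightarrow> Modal H_op (\<^bold>\<not> (Modal G_op (\<^bold>\<not> \<phi>)))) \<in> s4tluk_axioms"

inductive modal_derives :: "'i mfm set \<Rightarrow> 'i mfm set \<Rightarrow> 'i mfm \<Rightarrow> bool" for Ax \<Gamma> where
  axiom: "\<phi> \<in> Ax \<Longrightarrow> modal_derives Ax \<Gamma> \<phi>"
| premise: "\<phi> \<in> \<Gamma> \<Longrightarrow> modal_derives Ax \<Gamma> \<phi>"
| MP: "modal_derives Ax \<Gamma> \<phi> \<Longrightarrow> modal_derives Ax \<Gamma> (\<phi> \<^bold>\<rightarrow> \<psi>) \<Longrightarrow> modal_derives Ax \<Gamma> \<psi>"
| Nec: "modal_derives Ax \<Gamma> \<phi> \<Longrightarrow> modal_derives Ax \<Gamma> (Modal b \<phi>)"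

definition s4luk_derives :: "box mfm set \<Rightarrow> box mfm \<Rightarrow> bool" (infix "\<turnstile>\<^sub>S\<^sub>4\<^sub>L" 45) where
  "\<Gamma> \<turnstile>\<^sub>S\<^sub>4\<^sub>L \<phi> \<longleftrightarrow> modal_derives s4luk_axioms \<Gamma> \<phi>"

definition s4tluk_derives :: "tense mfm set \<Rightarrow> tense mfm \<Rightarrow> bool" (infix "\<turnstile>\<^sub>S\<^sub>4\<^sub>t\<^sub>L" 45) where
  "\<Gamma> \<turnstile>\<^sub>S\<^sub>4\<^sub>t\<^sub>L \<phi> \<longleftrightarrow> modal_derives s4tluk_axioms \<Gamma> \<phi>"


section \<open>Algebras\<close>

record 'a rl = "'a monoid" +
  rl_meet :: "'a \<Rightarrow> 'a \<Rightarrow> 'a" (infixl "\<curlywedge>\<index>" 70)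
  rl_join :: "'a \<Rightarrow> 'a \<Rightarrow> 'a" (infixl "\<curlyvee>\<index>" 65)
  rl_imp :: "'a \<Rightarrow> 'a \<Rightarrow> 'a" (infixr "\<leadsto>\<index>" 60)
  rl_zero :: 'a ("\<zero>\<index>")

record ('a, 'i) modal_rl = "'a rl" +
  rl_modal :: "'i \<Rightarrow> 'a \<Rightarrow> 'a"

definition rl_le :: "('a, 'm) rl_scheme \<Rightarrow> 'a \<Rightarrow> 'a \<Rightarrow> bool" (infix "\<preceq>\<index>" 50) where
  "x \<preceq>\<^bsub>A\<^esub> y \<longleftrightarrow> x \<curlywedge>\<^bsub>A\<^esub> y = x"

definition rl_neg :: "('a, 'm) rl_scheme \<Rightarrow> 'a \<Rightarrow> 'a" where
  "rl_neg A x = x \<leadsto>\<^bsub>A\<^esub> \<zero>\<^bsub>A\<^esub>"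

locale bounded_ci_residuated_lattice = comm_monoid A for A :: "('a, 'm) rl_scheme" (structure) +
  assumes meet_closed: "x \<in> carrier A \<Longrightarrow> y \<in> carrier A \<Longrightarrow> x \<curlywedge> y \<in> carrier A"
    and join_closed: "x \<in> carrier A \<Longrightarrow> y \<in> carrier A \<Longrightarrow> x \<curlyvee> y \<in> carrier A"
    and imp_closed: "x \<in> carrier A \<Longrightarrow> y \<in> carrier A \<Longrightarrow> x \<leadsto> y \<in> carrier A"
    and zero_closed: "\<zero> \<in> carrier A"
    and meet_assoc: "x \<in> carrier A \<Longrightarrow> y \<in> carrier A \<Longrightarrow> z \<in> carrier A \<Longrightarrow>
      (x \<curlywedge> y) \<curlywedge> z = x \<curlywedge> (y \<curlywedge> z)"
    and meet_comm: "x \<in> carrier A \<Longrightarrow> y \<in> carrier A \<Longrightarrow> x \<curlywedge> y = y \<curlywedge> x"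
    and join_assoc: "x \<in> carrier A \<Longrightarrow> y \<in> carrier A \<Longrightarrow> z \<in> carrier A \<Longrightarrow>
      (x \<curlyvee> y) \<curlyvee> z = x \<curlyvee> (y \<curlyvee> z)"
    and join_comm: "x \<in> carrier A \<Longrightarrow> y \<in> carrier A \<Longrightarrow> x \<curlyvee> y = y \<curlyvee> x"
    and meet_join_absorb: "x \<in> carrier A \<Longrightarrow> y \<in> carrier A \<Longrightarrow> x \<curlywedge> (x \<curlyvee> y) = x"
    and join_meet_absorb: "x \<in> carrier A \<Longrightarrow> y \<in> carrier A \<Longrightarrow> x \<curlyvee> (x \<curlywedge> y) = x"
    and zero_least: "x \<in> carrier A \<Longrightarrow> \<zero> \<preceq> x"
    and one_greatest: "x \<in> carrier A \<Longrightarrow> x \<preceq> \<one>"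
    and residuation: "x \<in> carrier A \<Longrightarrow> y \<in> carrier A \<Longrightarrow> z \<in> carrier A \<Longrightarrow>
      x \<otimes> y \<preceq> z \<longleftrightarrow> x \<preceq> y \<leadsto> z"

locale gbl_algebra = bounded_ci_residuated_lattice +
  assumes divisibility: "x \<in> carrier A \<Longrightarrow> y \<in> carrier A \<Longrightarrow> x \<otimes> (x \<leadsto> y) = x \<curlywedge> y"

locale mv_algebra = gbl_algebra +
  assumes prelinearity: "x \<in> carrier A \<Longrightarrow> y \<in> carrier A \<Longrightarrow> (x \<leadsto> y) \<curlyvee> (y \<leadsto> x) = \<one>"
    and involution: "x \<in> carrier A \<Longrightarrow> rl_neg A (rl_neg A x) = x"

definition rl_endo :: "('a, 'm) rl_scheme \<Rightarrow> ('a \<Rightarrow> 'a) \<Rightarrow> bool" where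
  "rl_endo A f \<longleftrightarrow> f \<in> carrier A \<rightarrow> carrier A \<and>
    (\<forall>x\<in>carrier A. \<forall>y\<in>carrier A. f (x \<curlywedge>\<^bsub>A\<^esub> y) = f x \<curlywedge>\<^bsub>A\<^esub> f y) \<and>
    (\<forall>x\<in>carrier A. \<forall>y\<in>carrier A. f (x \<otimes>\<^bsub>A\<^esub> y) = f x \<otimes>\<^bsub>A\<^esub> f y) \<and>
    f \<zero>\<^bsub>A\<^esub> = \<zero>\<^bsub>A\<^esub> \<and> f \<one>\<^bsub>A\<^esub> = \<one>\<^bsub>A\<^esub>"

definition interior_op :: "('a, 'm) rl_scheme \<Rightarrow> ('a \<Rightarrow> 'a) \<Rightarrow> bool" where
  "interior_op A f \<longleftrightarrow>
    (\<forall>x\<in>carrier A. f x \<preceq>\<^bsub>A\<^esub> x) \<and>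
    (\<forall>x\<in>carrier A. f (f x) = f x) \<and>
    (\<forall>x\<in>carrier A. \<forall>y\<in>carrier A. x \<preceq>\<^bsub>A\<^esub> y \<longrightarrow> f x \<preceq>\<^bsub>A\<^esub> f y)"

definition GBL :: "'a rl set" where
  "GBL = {A. gbl_algebra A}"

definition S4MV :: "('a, box) modal_rl set" where
  "S4MV = {A. mv_algebra A \<and> rl_endo A (rl_modal A Box) \<and> interior_op A (rl_modal A Box)}"

definition S4tMV :: "('a, tense) modal_rl set" where
  "S4tMV = {A. mv_algebra A \<and>
    (\<forall>b. rl_endo A (rl_modal A b) \<and> interior_op A (rl_modal A b)) \<and>
    (\<forall>x\<in>carrier A. \<forall>y\<in>carrier A.
      x \<preceq>\<^bsub>A\<^esub> rl_modal A G_op y \<longleftrightarrow> rl_neg A (rl_modal A H_op (rl_neg A x)) \<preceq>\<^bsub>A\<^esub> y)}"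


section \<open>Equational consequence\<close>

primrec eval :: "'a rl \<Rightarrow> (nat \<Rightarrow> 'a) \<Rightarrow> fm \<Rightarrow> 'a" where
  "eval A v (Var p) = v p"
| "eval A v Zero = \<zero>\<^bsub>A\<^esub>"
| "eval A v One = \<one>\<^bsub>A\<^esub>"
| "eval A v (Conj \<phi> \<psi>) = eval A v \<phi> \<curlywedge>\<^bsub>A\<^esub> eval A v \<psi>"
| "eval A v (Disj \<phi> \<psi>) = eval A v \<phi> \<curlyvee>\<^bsub>A\<^esub> eval A v \<psi>"
| "eval A v (Fus \<phi> \<psi>) = eval A v \<phi> \<otimes>\<^bsub>A\<^esub> eval A v \<psi>"
| "eval A v (Imp \<phi> \<psi>) = eval A v \<phi> \<leadsto>\<^bsub>A\<^esub> eval A v \<psi>"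

primrec modal_eval :: "('a, 'i) modal_rl \<Rightarrow> (nat \<Rightarrow> 'a) \<Rightarrow> 'i mfm \<Rightarrow> 'a" where
  "modal_eval A v (MVar p) = v p"
| "modal_eval A v MZero = \<zero>\<^bsub>A\<^esub>"
| "modal_eval A v MOne = \<one>\<^bsub>A\<^esub>"
| "modal_eval A v (MConj \<phi> \<psi>) = modal_eval A v \<phi> \<curlywedge>\<^bsub>A\<^esub> modal_eval A v \<psi>"
| "modal_eval A v (MDisj \<phi> \<psi>) = modal_eval A v \<phi> \<curlyvee>\<^bsub>A\<^esub> modal_eval A v \<psi>"
| "modal_eval A v (MFus \<phi> \<psi>) = modal_eval A v \<phi> \<otimes>\<^bsub>A\<^esub> modal_eval A v \<psi>"
| "modal_eval A v (MImp \<phi> \<psi>) = modal_eval A v \<phi> \<leadsto>\<^bsub>A\<^esub> modal_eval A v \<psi>"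
| "modal_eval A v (Modal b \<phi>) = rl_modal A b (modal_eval A v \<phi>)"

text \<open>An equation is a pair of formulas. A class of algebras is a set of algebras whose carriers
  are subsets of one type \<open>'a\<close>. Since the languages are countable, a failure of a consequence
  always occurs in a countable subalgebra, so every infinite type \<open>'a\<close> yields the consequence
  relation of the class of all algebras; a finite type does not.\<close>

definition eq_conseq :: "'a rl set \<Rightarrow> (fm \<times> fm) set \<Rightarrow> fm \<times> fm \<Rightarrow> bool" where
  "eq_conseq K \<Theta> e \<longleftrightarrow>
    (\<forall>A\<in>K. \<forall>v. range v \<subseteq> carrier A \<longrightarrow>
      (\<forall>(\<alpha>, \<beta>)\<in>\<Theta>. eval A v \<alpha> = eval A v \<beta>) \<longrightarrow> eval A v (fst e) = eval A v (snd e))"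

definition modal_eq_conseq ::
  "('a, 'i) modal_rl set \<Rightarrow> ('i mfm \<times> 'i mfm) set \<Rightarrow> 'i mfm \<times> 'i mfm \<Rightarrow> bool" where
  "modal_eq_conseq K \<Theta> e \<longleftrightarrow>
    (\<forall>A\<in>K. \<forall>v. range v \<subseteq> carrier A \<longrightarrow>
      (\<forall>(\<alpha>, \<beta>)\<in>\<Theta>. modal_eval A v \<alpha> = modal_eval A v \<beta>) \<longrightarrow>
      modal_eval A v (fst e) = modal_eval A v (snd e))"

end

theory Submission
  imports Defs "HOL-Library.Countable"
begin

text \<open>
  The fixed points of the box of an S4MV-algebra form a GBL-algebra with implication
  \<open>\<box>(x \<rightarrow> y)\<close>, and the translation of a formula evaluates like the formula itself in this
  algebra; with soundness and completeness of all three logics this gives one half.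

  For the other half, suppose that \<open>\<phi>\<close> does not follow from \<open>\<Gamma>\<close>. For every theory \<open>T\<close>
  containing \<open>\<Gamma>\<close> that is maximal among those that do not derive some \<open>\<chi>\<close>, the Lindenbaum
  algebra of \<open>T\<close> is subdirectly irreducible. By the Blok--Ferreirim argument it has on top a
  totally ordered Wajsberg hoop \<open>W\<close>, which is a filter and embeds into an MV-chain; sending
  everything outside \<open>W\<close> to 0 preserves all operations but implication. On the product
  of these chains over all pairs \<open>(T, \<chi>)\<close>, let \<open>G\<close> replace by 0 every component of
  \<open>x\<close> above which some component of \<open>x\<close> differs from 1, where \<open>(T', \<chi>')\<close> lies above
  \<open>(T, \<chi>)\<close> if \<open>T'\<close> contains the top filter of \<open>T\<close>, and let \<open>H\<close> do the same for the
  converse relation. The result is an S4tMV-algebra, and a truth lemma shows that it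
  refutes the translated consequence; its \<open>G\<close>-reduct is an S4MV-algebra.
\<close>


section \<open>Residuated lattices and subdirectly irreducible GBL-algebras\<close>


text \<open>Collapsing everything outside \<open>W\<close> to 0 can damage an implication only if
  its value lies outside \<open>W\<close>: the wanted value is then 0, but the chain may compute
  another one. \<open>G\<close> is the correction. Such an implication is not in the top filter, so
  some maximal theory containing this filter avoids it, and the pointwise implication differs from 1
  there. Hence all maximal theories over \<Gamma> have to occur as indices. The relation is
  transitive and also irreflexive, because \<chi> lies in the top filter of (T, \<chi>) but not in
  T. With the converse relation for \<open>H\<close>, both sides of the tense adjunction become the
  same condition on pairs of related components.

  The canonical algebra lives on a fixed function type, so it cannot itself refute a consequence
  over an arbitrary infinite type. It is therefore used only to refute derivability, by soundness.
  The equational claims then follow from completeness, whose Lindenbaum algebras are countable and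
  fit into every infinite type.\<close>

context bounded_ci_residuated_lattice
begin

declare meet_closed [simp] join_closed [simp] imp_closed [simp] zero_closed [simp]

lemma meet_idem [simp]: "x \<in> carrier A \<Longrightarrow> x \<curlywedge> x = x"
  by (metis join_meet_absorb meet_closed meet_join_absorb)

lemma join_idem [simp]: "x \<in> carrier A \<Longrightarrow> x \<curlyvee> x = x"
  by (metis join_meet_absorb meet_idem)

lemma rl_le_refl [simp]: "x \<in> carrier A \<Longrightarrow> x \<preceq> x"
  by (simp add: rl_le_def meet_idem)

lemma rl_le_trans: "x \<preceq> y \<Longrightarrow> y \<preceq> z \<Longrightarrow> x \<in> carrier A \<Longrightarrow> y \<in> carrier A \<Longrightarrow> z \<in> carrier A \<Longrightarrow> x \<preceq> z"
  unfolding rl_le_def by (metis meet_assoc)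

lemma rl_le_antisym: "x \<preceq> y \<Longrightarrow> y \<preceq> x \<Longrightarrow> x \<in> carrier A \<Longrightarrow> y \<in> carrier A \<Longrightarrow> x = y"
  unfolding rl_le_def by (metis meet_comm)

lemma meet_le1 [simp]: "x \<in> carrier A \<Longrightarrow> y \<in> carrier A \<Longrightarrow> x \<curlywedge> y \<preceq> x"
  unfolding rl_le_def by (metis meet_assoc meet_closed meet_comm meet_idem)

lemma meet_le2 [simp]: "x \<in> carrier A \<Longrightarrow> y \<in> carrier A \<Longrightarrow> x \<curlywedge> y \<preceq> y"
  by (metis meet_comm meet_le1)

lemma meet_greatest:
  "z \<preceq> x \<Longrightarrow> z \<preceq> y \<Longrightarrow> x \<in> carrier A \<Longrightarrow> y \<in> carrier A \<Longrightarrow> z \<in> carrier A \<Longrightarrow> z \<preceq> x \<curlywedge> y"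
  unfolding rl_le_def by (metis meet_assoc)

lemma join_ge1 [simp]: "x \<in> carrier A \<Longrightarrow> y \<in> carrier A \<Longrightarrow> x \<preceq> x \<curlyvee> y"
  unfolding rl_le_def by (rule meet_join_absorb)

lemma join_ge2 [simp]: "x \<in> carrier A \<Longrightarrow> y \<in> carrier A \<Longrightarrow> y \<preceq> x \<curlyvee> y"
  by (metis join_comm join_ge1)

lemma rl_le_iff_join: "x \<in> carrier A \<Longrightarrow> y \<in> carrier A \<Longrightarrow> x \<preceq> y \<longleftrightarrow> x \<curlyvee> y = y"
  unfolding rl_le_def by (metis join_comm join_meet_absorb meet_comm meet_join_absorb)

lemma join_least:
  "x \<preceq> z \<Longrightarrow> y \<preceq> z \<Longrightarrow> x \<in> carrier A \<Longrightarrow> y \<in> carrier A \<Longrightarrow> z \<in> carrier A \<Longrightarrow> x \<curlyvee> y \<preceq> z"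
  by (simp add: rl_le_iff_join join_assoc)

lemma rl_le_one [simp]: "x \<in> carrier A \<Longrightarrow> x \<preceq> \<one>"
  by (rule one_greatest)

lemma one_rl_le_iff: "x \<in> carrier A \<Longrightarrow> \<one> \<preceq> x \<longleftrightarrow> x = \<one>"
  by (metis one_closed one_greatest rl_le_antisym rl_le_refl)

lemma rl_le_iff_imp: "x \<in> carrier A \<Longrightarrow> y \<in> carrier A \<Longrightarrow> x \<preceq> y \<longleftrightarrow> x \<leadsto> y = \<one>"
  using residuation [of \<one> x y] by (simp add: one_rl_le_iff)

lemma imp_self [simp]: "x \<in> carrier A \<Longrightarrow> x \<leadsto> x = \<one>"
  by (metis rl_le_iff_imp rl_le_refl)

lemma imp_one [simp]: "x \<in> carrier A \<Longrightarrow> x \<leadsto> \<one> = \<one>"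
  by (metis rl_le_iff_imp one_closed one_greatest)

lemma zero_imp [simp]: "x \<in> carrier A \<Longrightarrow> \<zero> \<leadsto> x = \<one>"
  by (metis rl_le_iff_imp zero_closed zero_least)

lemma mult_imp_le [simp]: "x \<in> carrier A \<Longrightarrow> y \<in> carrier A \<Longrightarrow> x \<otimes> (x \<leadsto> y) \<preceq> y"
  by (metis imp_closed m_comm residuation rl_le_refl)

lemma imp_mult_le [simp]: "x \<in> carrier A \<Longrightarrow> y \<in> carrier A \<Longrightarrow> (x \<leadsto> y) \<otimes> x \<preceq> y"
  by (simp add: residuation)

text \<open>Indirect equality: identities between residuals become chains of
  \<open>residuation\<close>.\<close>

lemma eq_by_lower_sets:
  assumes "x \<in> carrier A" "y \<in> carrier A" "\<And>u. u \<in> carrier A \<Longrightarrow> u \<preceq> x \<longleftrightarrow> u \<preceq> y"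
  shows "x = y"
  using assms by (meson rl_le_antisym rl_le_refl)

lemma one_imp [simp]: "x \<in> carrier A \<Longrightarrow> \<one> \<leadsto> x = x"
  by (rule eq_by_lower_sets) (simp_all flip: residuation)

lemma imp_imp: "x \<in> carrier A \<Longrightarrow> y \<in> carrier A \<Longrightarrow> z \<in> carrier A \<Longrightarrow> x \<leadsto> (y \<leadsto> z) = (x \<otimes> y) \<leadsto> z"
  by (rule eq_by_lower_sets) (simp_all flip: residuation add: m_assoc)

lemma imp_exchange: "x \<in> carrier A \<Longrightarrow> y \<in> carrier A \<Longrightarrow> z \<in> carrier A \<Longrightarrow> x \<leadsto> (y \<leadsto> z) = y \<leadsto> (x \<leadsto> z)"
  by (simp add: imp_imp m_comm)

lemma mult_mono_left:
  assumes "x \<preceq> y" and [simp]: "x \<in> carrier A" "y \<in> carrier A" "z \<in> carrier A"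
  shows "x \<otimes> z \<preceq> y \<otimes> z"
proof -
  have "y \<preceq> z \<leadsto> (y \<otimes> z)" by (simp flip: residuation)
  then have "x \<preceq> z \<leadsto> (y \<otimes> z)" using assms(1) by (auto intro: rl_le_trans [of x y])
  then show ?thesis by (simp add: residuation)
qed

lemma mult_mono:
  assumes "x \<preceq> y" "u \<preceq> w" and [simp]: "x \<in> carrier A" "y \<in> carrier A" "u \<in> carrier A" "w \<in> carrier A"
  shows "x \<otimes> u \<preceq> y \<otimes> w"
  using mult_mono_left [OF assms(1), of u] mult_mono_left [OF assms(2), of y]
  by (simp add: m_comm [of _ y]) (rule rl_le_trans, auto)

lemma mult_le1 [simp]: "x \<in> carrier A \<Longrightarrow> y \<in> carrier A \<Longrightarrow> x \<otimes> y \<preceq> x"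
  using mult_mono [of x x y \<one>] by simp

lemma mult_le2 [simp]: "x \<in> carrier A \<Longrightarrow> y \<in> carrier A \<Longrightarrow> x \<otimes> y \<preceq> y"
  by (metis m_comm mult_le1)

lemma le_imp [simp]: "x \<in> carrier A \<Longrightarrow> y \<in> carrier A \<Longrightarrow> y \<preceq> x \<leadsto> y"
  by (simp flip: residuation)

lemma le_imp_imp [simp]: "x \<in> carrier A \<Longrightarrow> y \<in> carrier A \<Longrightarrow> x \<preceq> (x \<leadsto> y) \<leadsto> y"
  by (simp flip: residuation)

lemma imp_mono:
  assumes "x' \<preceq> x" "y \<preceq> y'"
    and [simp]: "x \<in> carrier A" "x' \<in> carrier A" "y \<in> carrier A" "y' \<in> carrier A"
  shows "x \<leadsto> y \<preceq> x' \<leadsto> y'"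
proof -
  have "(x \<leadsto> y) \<otimes> x' \<preceq> (x \<leadsto> y) \<otimes> x"
    using assms by (intro mult_mono) auto
  also have "(x \<leadsto> y) \<otimes> x \<preceq> y" by simp
  finally (rl_le_trans) have "(x \<leadsto> y) \<otimes> x' \<preceq> y" by simp
  then have "(x \<leadsto> y) \<otimes> x' \<preceq> y'" by (rule rl_le_trans) (use assms in auto)
  then show ?thesis by (simp add: residuation)
qed

lemma imp_imp_imp [simp]: "x \<in> carrier A \<Longrightarrow> y \<in> carrier A \<Longrightarrow> ((x \<leadsto> y) \<leadsto> y) \<leadsto> y = x \<leadsto> y"
  by (rule rl_le_antisym) (auto intro: imp_mono)

lemma imp_meet [simp]: "x \<in> carrier A \<Longrightarrow> y \<in> carrier A \<Longrightarrow> x \<leadsto> (x \<curlywedge> y) = x \<leadsto> y"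
proof (rule rl_le_antisym)
  assume [simp]: "x \<in> carrier A" "y \<in> carrier A"
  have "(x \<leadsto> y) \<otimes> x \<preceq> x \<curlywedge> y" by (rule meet_greatest) auto
  then show "x \<leadsto> y \<preceq> x \<leadsto> (x \<curlywedge> y)" by (simp flip: residuation)
qed (auto intro: imp_mono)

end

text \<open>The lattice laws follow from an order \<open>le\<close> by indirect equality. The
  MV-chains, quotients, fixed-point algebras and products below all come with an order that is
  easier to handle than their equations.\<close>

lemma gbl_algebraI:
  fixes A :: "('a, 'm) rl_scheme" (structure) and le :: "'a \<Rightarrow> 'a \<Rightarrow> bool"
  assumes closed: "\<zero> \<in> carrier A" "\<one> \<in> carrier A"
      "\<And>x y. x \<in> carrier A \<Longrightarrow> y \<in> carrier A \<Longrightarrow> x \<curlywedge> y \<in> carrier A"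
      "\<And>x y. x \<in> carrier A \<Longrightarrow> y \<in> carrier A \<Longrightarrow> x \<curlyvee> y \<in> carrier A"
      "\<And>x y. x \<in> carrier A \<Longrightarrow> y \<in> carrier A \<Longrightarrow> x \<otimes> y \<in> carrier A"
      "\<And>x y. x \<in> carrier A \<Longrightarrow> y \<in> carrier A \<Longrightarrow> x \<leadsto> y \<in> carrier A"
    and refl: "\<And>x. x \<in> carrier A \<Longrightarrow> le x x"
    and trans: "\<And>x y z. x \<in> carrier A \<Longrightarrow> y \<in> carrier A \<Longrightarrow> z \<in> carrier A \<Longrightarrow> le x y \<Longrightarrow> le y z \<Longrightarrow> le x z"
    and antisym: "\<And>x y. x \<in> carrier A \<Longrightarrow> y \<in> carrier A \<Longrightarrow> le x y \<Longrightarrow> le y x \<Longrightarrow> x = y"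
    and meet: "\<And>x y. x \<in> carrier A \<Longrightarrow> y \<in> carrier A \<Longrightarrow> le (x \<curlywedge> y) x"
      "\<And>x y. x \<in> carrier A \<Longrightarrow> y \<in> carrier A \<Longrightarrow> le (x \<curlywedge> y) y"
      "\<And>x y z. x \<in> carrier A \<Longrightarrow> y \<in> carrier A \<Longrightarrow> z \<in> carrier A \<Longrightarrow> le z x \<Longrightarrow> le z y \<Longrightarrow> le z (x \<curlywedge> y)"
    and join: "\<And>x y. x \<in> carrier A \<Longrightarrow> y \<in> carrier A \<Longrightarrow> le x (x \<curlyvee> y)"
      "\<And>x y. x \<in> carrier A \<Longrightarrow> y \<in> carrier A \<Longrightarrow> le y (x \<curlyvee> y)"
      "\<And>x y z. x \<in> carrier A \<Longrightarrow> y \<in> carrier A \<Longrightarrow> z \<in> carrier A \<Longrightarrow> le x z \<Longrightarrow> le y z \<Longrightarrow> le (x \<curlyvee> y) z"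
    and bounds: "\<And>x. x \<in> carrier A \<Longrightarrow> le \<zero> x" "\<And>x. x \<in> carrier A \<Longrightarrow> le x \<one>"
    and assoc: "\<And>x y z. x \<in> carrier A \<Longrightarrow> y \<in> carrier A \<Longrightarrow> z \<in> carrier A \<Longrightarrow> (x \<otimes> y) \<otimes> z = x \<otimes> (y \<otimes> z)"
    and comm: "\<And>x y. x \<in> carrier A \<Longrightarrow> y \<in> carrier A \<Longrightarrow> x \<otimes> y = y \<otimes> x"
    and unit: "\<And>x. x \<in> carrier A \<Longrightarrow> \<one> \<otimes> x = x"
    and resid: "\<And>x y z. x \<in> carrier A \<Longrightarrow> y \<in> carrier A \<Longrightarrow> z \<in> carrier A \<Longrightarrow>
      le (x \<otimes> y) z \<longleftrightarrow> le x (y \<leadsto> z)"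
    and divis: "\<And>x y. x \<in> carrier A \<Longrightarrow> y \<in> carrier A \<Longrightarrow> x \<otimes> (x \<leadsto> y) = x \<curlywedge> y"
  shows "gbl_algebra A"
    and "\<And>x y. x \<in> carrier A \<Longrightarrow> y \<in> carrier A \<Longrightarrow> x \<preceq> y \<longleftrightarrow> le x y"
proof -
  show le: "x \<preceq> y \<longleftrightarrow> le x y" if "x \<in> carrier A" "y \<in> carrier A" for x y
  proof
    assume "x \<preceq> y"
    then show "le x y" using meet(2) [OF that] by (simp add: rl_le_def)
  next
    assume "le x y"
    then show "x \<preceq> y" unfolding rl_le_def
      using that by (intro antisym closed meet refl)
  qed
  have meet_eqI: "u = w" if "u \<in> carrier A" "w \<in> carrier A"
    "\<And>t. t \<in> carrier A \<Longrightarrow> le t u \<longleftrightarrow> le t w" for u w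
    using that(1,2) that(3) [of u] that(3) [of w] by (intro antisym) (auto simp: refl)
  have join_eqI: "u = w" if "u \<in> carrier A" "w \<in> carrier A"
    "\<And>t. t \<in> carrier A \<Longrightarrow> le u t \<longleftrightarrow> le w t" for u w
    using that(1,2) that(3) [of u] that(3) [of w] by (intro antisym) (auto simp: refl)
  have le_meet: "le t (x \<curlywedge> y) \<longleftrightarrow> le t x \<and> le t y"
    if "x \<in> carrier A" "y \<in> carrier A" "t \<in> carrier A" for t x y
    using that by (auto intro: meet trans [OF _ _ _ _ meet(1)] trans [OF _ _ _ _ meet(2)] closed)
  have join_le: "le (x \<curlyvee> y) t \<longleftrightarrow> le x t \<and> le y t"
    if "x \<in> carrier A" "y \<in> carrier A" "t \<in> carrier A" for t x y
    using that by (auto intro: join trans [OF _ _ _ join(1)] trans [OF _ _ _ join(2)] closed)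
  show "gbl_algebra A"
  proof
    show "x \<otimes> \<one> = x" if "x \<in> carrier A" for x using that comm unit closed by metis
    show "(x \<curlywedge> y) \<curlywedge> z = x \<curlywedge> (y \<curlywedge> z)" if "x \<in> carrier A" "y \<in> carrier A" "z \<in> carrier A" for x y z
      using that by (intro meet_eqI) (auto simp: le_meet closed)
    show "x \<curlywedge> y = y \<curlywedge> x" if "x \<in> carrier A" "y \<in> carrier A" for x y
      using that by (intro meet_eqI) (auto simp: le_meet closed)
    show "(x \<curlyvee> y) \<curlyvee> z = x \<curlyvee> (y \<curlyvee> z)" if "x \<in> carrier A" "y \<in> carrier A" "z \<in> carrier A" for x y z
      using that by (intro join_eqI) (auto simp: join_le closed)
    show "x \<curlyvee> y = y \<curlyvee> x" if "x \<in> carrier A" "y \<in> carrier A" for x y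
      using that by (intro join_eqI) (auto simp: join_le closed)
    show "x \<curlywedge> (x \<curlyvee> y) = x" if "x \<in> carrier A" "y \<in> carrier A" for x y
      using that by (intro antisym) (auto simp: le_meet closed refl join meet)
    show "x \<curlyvee> (x \<curlywedge> y) = x" if "x \<in> carrier A" "y \<in> carrier A" for x y
      using that by (intro antisym) (auto simp: join_le closed refl join meet)
  qed (fact closed assoc comm unit bounds resid divis | (simp only: le closed; fact bounds resid))+
qed

section \<open>Subdirectly irreducible GBL-algebras and their top component\<close>

context gbl_algebra
begin

lemma mult_imp_of_le:
  "y \<preceq> x \<Longrightarrow> x \<in> carrier A \<Longrightarrow> y \<in> carrier A \<Longrightarrow> x \<otimes> (x \<leadsto> y) = y"
  using meet_comm [of x y] by (simp add: divisibility rl_le_def)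

end

text \<open>Congruences of a GBL-algebra correspond to filters, and the filter generated by
  \<open>x\<close> is the upward closure of the powers of \<open>x\<close>. So
  \<open>pow_le_c\<close> puts \<open>c\<close> into every nontrivial filter: this is subdirect
  irreducibility, in the form that the local deduction theorem delivers.\<close>

locale si_gbl_algebra = gbl_algebra +
  fixes c
  assumes c_closed [simp]: "c \<in> carrier A"
    and c_neq_one: "c \<noteq> \<one>"
    and pow_le_c: "x \<in> carrier A \<Longrightarrow> x \<noteq> \<one> \<Longrightarrow> \<exists>n::nat. x [^] n \<preceq> c"
begin

lemma pow_imp_fixed:
  assumes "g \<leadsto> p = p" and [simp]: "g \<in> carrier A" "p \<in> carrier A"
  shows "g [^] (n::nat) \<leadsto> p = p"
  by (induction n) (simp_all flip: imp_imp add: assms(1))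

lemma fixed_by_c_antimono:
  assumes "c \<leadsto> x = x" "c \<preceq> d" and [simp]: "x \<in> carrier A" "d \<in> carrier A"
  shows "d \<leadsto> x = x"
  by (rule rl_le_antisym) (use assms imp_mono [of c d x x] in auto)

text \<open>Some power of \<open>g\<close> lies below \<open>c\<close>, and residuals by powers of
  \<open>g\<close> still fix \<open>p\<close>. Hence \<open>c\<close> alone tests whether any
  element other than 1 fixes \<open>p\<close>.\<close>

lemma fixed_by_c:
  assumes "g \<leadsto> p = p" "g \<noteq> \<one>" and [simp]: "g \<in> carrier A" "p \<in> carrier A"
  shows "c \<leadsto> p = p"
proof -
  obtain n :: nat where "g [^] n \<preceq> c" using pow_le_c [OF assms(3,2)] by blast
  then have "c \<leadsto> p \<preceq> g [^] n \<leadsto> p" by (intro imp_mono) auto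
  then show ?thesis by (simp add: pow_imp_fixed assms(1) rl_le_antisym)
qed

text \<open>The element \<open>e = x \<leadsto> c\<close> lies above \<open>c\<close> and so fixes
  \<open>x\<close>; comparing two instances of divisibility, \<open>x\<close> in turn fixes
  \<open>e\<close>. As some power of \<open>x\<close> lies below \<open>c\<close> and thus below
  \<open>e\<close>, this forces \<open>e = \<one>\<close>.\<close>

lemma le_c_of_fixed:
  assumes fixed: "c \<leadsto> x = x" and "x \<noteq> \<one>" and [simp]: "x \<in> carrier A"
  shows "x \<preceq> c"
proof -
  let ?e = "x \<leadsto> c"
  have "?e \<leadsto> x = x" by (rule fixed_by_c_antimono [OF fixed]) auto
  then have "x \<curlywedge> ?e = ?e \<otimes> x" using divisibility [of ?e x] meet_comm [of x ?e] by simp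
  then have "x \<curlywedge> ?e = x \<curlywedge> c" by (simp add: m_comm [of ?e x] divisibility)
  then have "x \<leadsto> ?e = ?e" using imp_meet [of x ?e] imp_meet [of x c] by simp
  then have pow: "x [^] (n::nat) \<leadsto> ?e = ?e" for n by (rule pow_imp_fixed) auto
  obtain n :: nat where "x [^] n \<preceq> c" using pow_le_c [OF assms(3,2)] by blast
  then have "x [^] n \<preceq> ?e" by (rule rl_le_trans) auto
  then have "x [^] n \<leadsto> ?e = \<one>" by (simp add: rl_le_iff_imp)
  then show ?thesis using pow by (simp add: rl_le_iff_imp)
qed

text \<open>From \<open>y \<preceq> c\<close> and divisibility, \<open>y \<otimes> c = y\<close>. So
  \<open>y\<close> cannot tell \<open>c \<leadsto> x\<close> from \<open>x\<close>: their meets with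
  \<open>y\<close> agree, and it remains to bound \<open>c \<leadsto> x\<close> by
  \<open>y\<close>.\<close>

lemma fixed_downward:
  assumes le: "x \<preceq> y" and fixed: "c \<leadsto> y = y" and "y \<noteq> \<one>"
    and [simp]: "x \<in> carrier A" "y \<in> carrier A"
  shows "c \<leadsto> x = x"
proof -
  let ?z = "c \<leadsto> x"
  have "y \<preceq> c" by (rule le_c_of_fixed) fact+
  then have cy: "y \<otimes> c = y" using mult_imp_of_le [of y c] fixed by (simp add: m_comm)
  have "c \<otimes> ?z \<preceq> y" by (rule rl_le_trans [of _ x]) (use le in auto)
  then have "c \<preceq> ?z \<leadsto> y" by (simp flip: residuation)
  \<comment> \<open>An element above \<open>c\<close> fixes \<open>y\<close> as well, so the double
    residual that bounds \<open>?z\<close> collapses to \<open>y\<close>.\<close>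
  then have "(?z \<leadsto> y) \<leadsto> y = y" by (rule fixed_by_c_antimono [OF fixed]) simp_all
  then have "?z \<preceq> y" using le_imp_imp [of ?z y] by simp
  have "y \<leadsto> ?z = y \<leadsto> x" by (simp add: imp_imp cy)
  then have "y \<curlywedge> ?z = y \<curlywedge> x" using divisibility [of y ?z] divisibility [of y x] by simp
  with \<open>?z \<preceq> y\<close> le show ?thesis by (simp add: rl_le_def meet_comm)
qed

text \<open>The Blok--Ferreirim decomposition: modulo the identification of the units,
  the algebra is the ordinal sum of \<open>{x. c \<leadsto> x = x}\<close> and this totally ordered
  Wajsberg hoop.\<close>

definition top_comp :: "'a set" where
  "top_comp = {x \<in> carrier A. x = \<one> \<or> c \<leadsto> x \<noteq> x}"

lemma top_comp_carrier: "x \<in> top_comp \<Longrightarrow> x \<in> carrier A"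
  by (simp add: top_comp_def)

lemma one_top_comp [simp]: "\<one> \<in> top_comp"
  by (simp add: top_comp_def)

lemma c_top_comp: "c \<in> top_comp"
  using c_neq_one by (auto simp: top_comp_def)

lemma top_comp_upward: "x \<in> top_comp \<Longrightarrow> x \<preceq> y \<Longrightarrow> y \<in> carrier A \<Longrightarrow> y \<in> top_comp"
  unfolding top_comp_def using fixed_downward one_rl_le_iff by auto

lemma top_comp_imp [simp]: "x \<in> carrier A \<Longrightarrow> y \<in> top_comp \<Longrightarrow> x \<leadsto> y \<in> top_comp"
  by (rule top_comp_upward [of y]) (simp_all add: top_comp_carrier)

text \<open>If \<open>c\<close> fixed the product, it would fix
  \<open>x \<leadsto> (x \<otimes> y)\<close> by exchange. This residual lies above
  \<open>y\<close>, hence in the component, where only 1 is fixed. Then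
  \<open>x \<preceq> x \<otimes> y\<close>, against upward closure.\<close>

lemma top_comp_mult [simp]:
  assumes "x \<in> top_comp" "y \<in> top_comp"
  shows "x \<otimes> y \<in> top_comp"
proof (rule ccontr)
  assume contra: "x \<otimes> y \<notin> top_comp"
  have [simp]: "x \<in> carrier A" "y \<in> carrier A" using assms top_comp_carrier by auto
  have fixed: "c \<leadsto> (x \<otimes> y) = x \<otimes> y" using contra by (simp add: top_comp_def)
  let ?u = "x \<leadsto> (x \<otimes> y)"
  have "c \<leadsto> ?u = ?u" by (simp add: imp_exchange [of c] fixed)
  moreover have "?u \<in> top_comp"
    by (rule top_comp_upward [of y]) (use assms in \<open>auto simp flip: residuation simp: m_comm\<close>)
  ultimately have "?u = \<one>" by (simp add: top_comp_def)
  then have "x \<preceq> x \<otimes> y" by (simp add: rl_le_iff_imp)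
  then show False using assms contra top_comp_upward by auto
qed

lemma top_comp_meet [simp]: "x \<in> top_comp \<Longrightarrow> y \<in> top_comp \<Longrightarrow> x \<curlywedge> y \<in> top_comp"
  by (metis divisibility top_comp_carrier top_comp_imp top_comp_mult)

lemma top_comp_join [simp]: "x \<in> top_comp \<Longrightarrow> y \<in> top_comp \<Longrightarrow> x \<curlyvee> y \<in> top_comp"
  by (rule top_comp_upward [of x]) (simp_all add: top_comp_carrier)

text \<open>If \<open>c\<close> fixes \<open>y\<close>, it fixes \<open>x \<leadsto> y\<close> by
  exchange; if it fixes \<open>x \<noteq> \<one>\<close>, then \<open>c \<otimes> x = x\<close>, and
  it fixes \<open>x \<leadsto> y\<close> again.\<close>

lemma top_comp_of_imp:
  assumes "x \<leadsto> y \<in> top_comp" "x \<leadsto> y \<noteq> \<one>" and [simp]: "x \<in> carrier A" "y \<in> carrier A"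
  shows "x \<in> top_comp" "y \<in> top_comp"
proof -
  have not_fixed: "c \<leadsto> (x \<leadsto> y) \<noteq> x \<leadsto> y" using assms by (simp add: top_comp_def)
  show "y \<in> top_comp" using not_fixed by (auto simp: top_comp_def imp_exchange [of c])
  show "x \<in> top_comp"
  proof (rule ccontr)
    assume "x \<notin> top_comp"
    then have "c \<leadsto> x = x" "x \<noteq> \<one>" by (auto simp: top_comp_def)
    then have "c \<otimes> x = x" using le_c_of_fixed mult_imp_of_le [of x c] by simp
    then show False using not_fixed by (simp add: imp_imp)
  qed
qed

lemma below_top_comp: "x \<in> top_comp \<Longrightarrow> y \<in> carrier A \<Longrightarrow> y \<notin> top_comp \<Longrightarrow> y \<preceq> x"
  using top_comp_of_imp(1) [of y x] top_comp_carrier [of x] by (auto simp: rl_le_iff_imp)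

text \<open>The engine of the Wajsberg law and of linearity: both proofs exhibit an equation
  \<open>g \<leadsto> p = p\<close> inside the component and conclude that \<open>g\<close> or
  \<open>p\<close> is 1.\<close>

lemma fixed_in_top_comp:
  "g \<leadsto> p = p \<Longrightarrow> g \<in> carrier A \<Longrightarrow> p \<in> top_comp \<Longrightarrow> g = \<one> \<or> p = \<one>"
  using fixed_by_c [of g p] by (auto simp: top_comp_def)

declare top_comp_carrier [simp]

text \<open>Divisibility gives \<open>?s \<otimes> ?g = x\<close>, and since the triple residual is
  the single one, \<open>?g\<close> fixes \<open>?p\<close>. So one of them is 1:
  \<open>?g = \<one>\<close> is the missing inequality, and \<open>?p = \<one>\<close> means
  \<open>x = y\<close>.\<close>

lemma top_comp_wajsberg:
  assumes le: "y \<preceq> x" and y: "y \<in> top_comp" and [simp]: "x \<in> carrier A"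
  shows "(x \<leadsto> y) \<leadsto> y = x"
proof -
  have [simp]: "y \<in> carrier A" using y by simp
  let ?p = "x \<leadsto> y" and ?s = "(x \<leadsto> y) \<leadsto> y"
  let ?g = "?s \<leadsto> x"
  have "?s \<otimes> ?g = x" by (rule mult_imp_of_le) auto
  then have "?p = (?g \<otimes> ?s) \<leadsto> y" by (simp add: m_comm)
  also have "\<dots> = ?g \<leadsto> ?p" by (simp flip: imp_imp)
  finally have "?g = \<one> \<or> ?p = \<one>" using y by (intro fixed_in_top_comp) auto
  then show ?thesis
  proof
    assume "?g = \<one>"
    then have "?s \<preceq> x" by (simp add: rl_le_iff_imp)
    then show ?thesis by (rule rl_le_antisym) auto
  next
    assume "?p = \<one>"
    then have "x = y" using le by (simp add: rl_le_iff_imp [symmetric] rl_le_antisym)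
    then show ?thesis by simp
  qed
qed

text \<open>The Wajsberg law gives \<open>?p \<leadsto> ?m = x\<close>, so by exchange
  \<open>?p\<close> fixes \<open>?q\<close>, and one of the two implications is 1.\<close>

lemma top_comp_total:
  assumes "x \<in> top_comp" "y \<in> top_comp"
  shows "x \<preceq> y \<or> y \<preceq> x"
proof -
  have [simp]: "x \<in> carrier A" "y \<in> carrier A" using assms by auto
  let ?m = "x \<curlywedge> y" and ?p = "x \<leadsto> y" and ?q = "y \<leadsto> x"
  have q: "?q = y \<leadsto> ?m" by (simp add: meet_comm [of x])
  have "?p \<leadsto> ?m = x" using top_comp_wajsberg [of ?m x] assms by simp
  moreover have "?p \<leadsto> (y \<leadsto> ?m) = y \<leadsto> (?p \<leadsto> ?m)" by (rule imp_exchange) auto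
  ultimately have "?p \<leadsto> ?q = ?q" using q by metis
  then have "?p = \<one> \<or> ?q = \<one>" using assms by (intro fixed_in_top_comp) auto
  then show ?thesis by (simp add: rl_le_iff_imp)
qed

text \<open>The element \<open>m\<close> strictly below the product leaves room for cancellation: it
  puts \<open>y \<leadsto> m\<close> and \<open>?z \<leadsto> m\<close> below \<open>x\<close>,
  where divisibility recovers each from its residual by \<open>x\<close>. These residuals agree
  because the products of \<open>x\<close> with \<open>y\<close> and \<open>?z\<close> do, and the
  Wajsberg law removes \<open>m\<close> again.\<close>

lemma top_comp_cancel:
  assumes mem: "x \<in> top_comp" "y \<in> top_comp" "m \<in> top_comp"
    and m: "m \<preceq> x \<otimes> y" "m \<noteq> x \<otimes> y"
  shows "x \<leadsto> (x \<otimes> y) = y"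
proof -
  have [simp]: "x \<in> carrier A" "y \<in> carrier A" "m \<in> carrier A" using mem by auto
  let ?z = "x \<leadsto> (x \<otimes> y)"
  have yz: "y \<preceq> ?z" by (simp flip: residuation add: m_comm)
  have my: "m \<preceq> y" by (rule rl_le_trans [OF m(1)]) auto
  have mz: "m \<preceq> ?z" by (rule rl_le_trans [OF my yz]) auto
  have xz: "x \<otimes> ?z = x \<otimes> y" by (rule mult_imp_of_le) auto
  \<comment> \<open>Otherwise \<open>x \<otimes> y \<preceq> m\<close>; linearity then gives the
    converse comparison.\<close>
  have "\<not> x \<preceq> y \<leadsto> m"
    using m rl_le_antisym by (auto simp flip: residuation)
  then have ym: "y \<leadsto> m \<preceq> x" using top_comp_total [of x "y \<leadsto> m"] mem by simp
  have zm: "?z \<leadsto> m \<preceq> x"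
    by (rule rl_le_trans [OF _ ym]) (use yz in \<open>auto intro: imp_mono\<close>)
  have eq: "x \<leadsto> (y \<leadsto> m) = x \<leadsto> (?z \<leadsto> m)" by (simp add: imp_imp xz)
  have "y \<leadsto> m = x \<otimes> (x \<leadsto> (y \<leadsto> m))" by (rule mult_imp_of_le [OF ym, symmetric]) auto
  also have "\<dots> = ?z \<leadsto> m" unfolding eq by (rule mult_imp_of_le [OF zm]) auto
  finally have "y \<leadsto> m = ?z \<leadsto> m" .
  moreover have "(y \<leadsto> m) \<leadsto> m = y" "(?z \<leadsto> m) \<leadsto> m = ?z"
    by (rule top_comp_wajsberg [OF my mem(3)] top_comp_wajsberg [OF mz mem(3)]; simp)+
  ultimately show ?thesis by metis
qed

section \<open>The MV-chain of the top component\<close>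

definition top_unbounded :: bool where
  "top_unbounded \<longleftrightarrow> \<not> (\<exists>a\<in>top_comp. \<forall>w\<in>top_comp. a \<preceq> w)"

definition top_least :: 'a where
  "top_least = (SOME a. a \<in> top_comp \<and> (\<forall>w\<in>top_comp. a \<preceq> w))"

lemma top_least:
  assumes "\<not> top_unbounded"
  shows "top_least \<in> top_comp" "\<And>w. w \<in> top_comp \<Longrightarrow> top_least \<preceq> w"
  using someI_ex [of "\<lambda>a. a \<in> top_comp \<and> (\<forall>w\<in>top_comp. a \<preceq> w)"] assms
  unfolding top_unbounded_def top_least_def by blast+

lemma top_unbounded_cancel:
  assumes "top_unbounded" "x \<in> top_comp" "y \<in> top_comp"
  shows "x \<leadsto> (x \<otimes> y) = y"
proof -
  obtain m where "m \<in> top_comp" "\<not> x \<otimes> y \<preceq> m"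
    using assms unfolding top_unbounded_def by (meson top_comp_mult)
  then show ?thesis using top_comp_cancel [of x y m] top_comp_total [of "x \<otimes> y" m] assms
    by fastforce
qed

lemma top_comp_imp_imp:
  assumes "a \<in> top_comp" "b \<in> top_comp"
  shows "(b \<leadsto> a) \<leadsto> a = a \<curlyvee> b"
  using top_comp_total [OF assms]
proof
  assume "a \<preceq> b"
  then show ?thesis using assms by (simp add: top_comp_wajsberg rl_le_iff_join)
next
  assume "b \<preceq> a"
  then have "b \<leadsto> a = \<one>" using assms by (simp add: rl_le_iff_imp)
  moreover have "b \<curlyvee> a = a" using \<open>b \<preceq> a\<close> assms by (simp add: rl_le_iff_join)
  ultimately show ?thesis using assms by (simp add: join_comm)
qed

text \<open>If the top component has a least element, it is an MV-chain with this element as zero.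
  Otherwise it is cancellative, and a reversed copy \<open>(a, False)\<close>, playing the role
  of the negation of \<open>(a, True)\<close>, is put below it, as in Chang's MV-chain.\<close>

definition top_mv :: "('a \<times> bool) rl" where
  "top_mv = \<lparr>
    carrier = {(a, t). a \<in> top_comp \<and> (t \<or> top_unbounded)},
    mult = (\<lambda>(a, s) (b, t).
      if s then if t then (a \<otimes> b, True) else (a \<leadsto> b, False)
      else if t then (b \<leadsto> a, False) else (\<one>, False)),
    one = (\<one>, True),
    rl_meet = (\<lambda>(a, s) (b, t).
      if s then if t then (a \<curlywedge> b, True) else (b, False)
      else if t then (a, False) else (a \<curlyvee> b, False)),
    rl_join = (\<lambda>(a, s) (b, t).
      if s then if t then (a \<curlyvee> b, True) else (a, True)
      else if t then (b, True) else (a \<curlywedge> b, False)),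
    rl_imp = (\<lambda>(a, s) (b, t).
      if s then if t then (a \<leadsto> b, True) else (a \<otimes> b, False)
      else if t then (\<one>, True) else (b \<leadsto> a, True)),
    rl_zero = (if top_unbounded then (\<one>, False) else (top_least, True))\<rparr>"

fun top_le :: "'a \<times> bool \<Rightarrow> 'a \<times> bool \<Rightarrow> bool" where
  "top_le (a, s) (b, t) \<longleftrightarrow> (if s then t \<and> a \<preceq> b else t \<or> b \<preceq> a)"

lemma top_mv_gbl: "gbl_algebra top_mv"
proof (rule gbl_algebraI(1) [of top_mv top_le], goal_cases)
  case 1 then show ?case by (auto simp: top_mv_def top_least)
next
  case 2 then show ?case by (auto simp: top_mv_def)
next
  case 3 then show ?case by (auto simp: top_mv_def)
next
  case 4 then show ?case by (auto simp: top_mv_def)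
next
  case 5 then show ?case by (auto simp: top_mv_def)
next
  case 6 then show ?case by (auto simp: top_mv_def)
next
  case 7 then show ?case by (auto simp: top_mv_def)
next
  case (8 x y z) then show ?case
    using rl_le_trans [of "fst x" "fst y" "fst z"] rl_le_trans [of "fst z" "fst y" "fst x"]
    by (auto simp: top_mv_def split: if_splits)
next
  case 9 then show ?case by (auto simp: top_mv_def split: if_splits intro: rl_le_antisym)
next
  case 10 then show ?case by (auto simp: top_mv_def)
next
  case 11 then show ?case by (auto simp: top_mv_def)
next
  case (12 x y z) then show ?case
    using meet_greatest [of "fst z" "fst x" "fst y"] join_least [of "fst x" "fst z" "fst y"]
    by (auto simp: top_mv_def split: if_splits)
next
  case 13 then show ?case by (auto simp: top_mv_def)
next
  case 14 then show ?case by (auto simp: top_mv_def)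
next
  case (15 x y z) then show ?case
    using meet_greatest [of "fst z" "fst x" "fst y"] join_least [of "fst x" "fst z" "fst y"]
    by (auto simp: top_mv_def split: if_splits)
next
  case 16 then show ?case by (auto simp: top_mv_def top_least)
next
  case 17 then show ?case by (auto simp: top_mv_def)
next
  case 18 then show ?case by (auto simp: top_mv_def imp_imp m_ac)
next
  case 19 then show ?case by (auto simp: top_mv_def m_comm)
next
  case 20 then show ?case by (auto simp: top_mv_def)
next
  case 21 then show ?case
    by (auto simp: top_mv_def m_comm simp flip: residuation split: if_splits)
next
  \<comment> \<open>Divisibility of a reversed element by an unreversed one is cancellation; for two
    reversed elements it is the join formula.\<close>
  case 22 then show ?case
    by (auto simp: top_mv_def divisibility top_unbounded_cancel top_comp_imp_imp)
qed

lemma top_mv_le: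
  "x \<in> carrier top_mv \<Longrightarrow> y \<in> carrier top_mv \<Longrightarrow> x \<preceq>\<^bsub>top_mv\<^esub> y \<longleftrightarrow> top_le x y"
  using rl_le_iff_join [of "fst y" "fst x"]
  by (auto simp: top_mv_def rl_le_def join_comm split: if_splits)

lemma top_mv_mv: "mv_algebra top_mv"
proof -
  interpret M: gbl_algebra top_mv by (rule top_mv_gbl)
  show ?thesis
  proof
    fix x y assume *: "x \<in> carrier top_mv" "y \<in> carrier top_mv"
    then have "top_le x y \<or> top_le y x"
      using top_comp_total [of "fst x" "fst y"] by (auto simp: top_mv_def split: if_splits)
    then have "x \<preceq>\<^bsub>top_mv\<^esub> y \<or> y \<preceq>\<^bsub>top_mv\<^esub> x" using * by (simp add: top_mv_le)
    then show "(x \<leadsto>\<^bsub>top_mv\<^esub> y) \<curlyvee>\<^bsub>top_mv\<^esub> (y \<leadsto>\<^bsub>top_mv\<^esub> x) = \<one>\<^bsub>top_mv\<^esub>"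
    proof
      assume "x \<preceq>\<^bsub>top_mv\<^esub> y"
      then show ?thesis using * M.rl_le_iff_join [of "y \<leadsto>\<^bsub>top_mv\<^esub> x" "\<one>\<^bsub>top_mv\<^esub>"]
        by (simp add: M.rl_le_iff_imp M.join_comm)
    next
      assume "y \<preceq>\<^bsub>top_mv\<^esub> x"
      then show ?thesis using * M.rl_le_iff_join [of "x \<leadsto>\<^bsub>top_mv\<^esub> y" "\<one>\<^bsub>top_mv\<^esub>"]
        by (simp add: M.rl_le_iff_imp)
    qed
  next
    fix x assume "x \<in> carrier top_mv"
    then show "rl_neg top_mv (rl_neg top_mv x) = x"
      by (auto simp: top_mv_def rl_neg_def top_least top_comp_wajsberg)
  qed
qed

section \<open>The map into the MV-chain\<close>

definition top_hom :: "'a \<Rightarrow> 'a \<times> bool" where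
  "top_hom x = (if x \<in> top_comp then (x, True) else \<zero>\<^bsub>top_mv\<^esub>)"

lemma top_hom_closed: "top_hom x \<in> carrier top_mv"
  by (auto simp: top_hom_def top_mv_def top_least)

lemma top_hom_one: "top_hom \<one> = \<one>\<^bsub>top_mv\<^esub>"
  by (auto simp: top_hom_def top_mv_def)

lemma top_hom_zero: "top_hom \<zero> = \<zero>\<^bsub>top_mv\<^esub>"
proof (cases "\<zero> \<in> top_comp")
  case True
  then have nu: "\<not> top_unbounded" unfolding top_unbounded_def
    using zero_least by (meson top_comp_carrier)
  have "top_least = \<zero>"
    using top_least [OF nu] True by (intro rl_le_antisym) (auto intro: zero_least)
  then show ?thesis using True nu by (simp add: top_hom_def top_mv_def)
qed (simp add: top_hom_def)

text \<open>In the bounded case \<open>top_least\<close> is also the image of everything outside the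
  component, so it has to behave as a zero towards the component.\<close>

lemma top_least_mult [simp]:
  assumes "\<not> top_unbounded" "x \<in> top_comp"
  shows "x \<otimes> top_least = top_least" "top_least \<otimes> x = top_least"
    "x \<curlywedge> top_least = top_least" "top_least \<curlywedge> x = top_least"
    "x \<curlyvee> top_least = x" "top_least \<curlyvee> x = x"
proof -
  note l = top_least [OF assms(1)]
  have [simp]: "x \<in> carrier A" "top_least \<in> carrier A" using l assms by auto
  show 1: "x \<otimes> top_least = top_least"
    using l assms by (intro rl_le_antisym) auto
  then show "top_least \<otimes> x = top_least" by (simp add: m_comm)
  show 2: "top_least \<curlywedge> x = top_least" using l(2) [OF assms(2)] by (simp add: rl_le_def)
  then show "x \<curlywedge> top_least = top_least" by (simp add: meet_comm)
  show 3: "top_least \<curlyvee> x = x" using l(2) [OF assms(2)] by (simp add: rl_le_iff_join)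
  then show "x \<curlyvee> top_least = x" by (simp add: join_comm)
qed

lemma not_top_compI: "y \<notin> top_comp \<Longrightarrow> x \<preceq> y \<Longrightarrow> y \<in> carrier A \<Longrightarrow> x \<notin> top_comp"
  using top_comp_upward by blast

lemma top_hom_mult:
  assumes [simp]: "x \<in> carrier A" "y \<in> carrier A"
  shows "top_hom (x \<otimes> y) = top_hom x \<otimes>\<^bsub>top_mv\<^esub> top_hom y"
  using not_top_compI [of x "x \<otimes> y"] not_top_compI [of y "x \<otimes> y"]
  by (auto simp: top_hom_def top_mv_def top_least)

lemma top_hom_meet:
  assumes [simp]: "x \<in> carrier A" "y \<in> carrier A"
  shows "top_hom (x \<curlywedge> y) = top_hom x \<curlywedge>\<^bsub>top_mv\<^esub> top_hom y"
  using not_top_compI [of x "x \<curlywedge> y"] not_top_compI [of y "x \<curlywedge> y"]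
  by (auto simp: top_hom_def top_mv_def top_least)

lemma top_hom_join:
  assumes [simp]: "x \<in> carrier A" "y \<in> carrier A"
  shows "top_hom (x \<curlyvee> y) = top_hom x \<curlyvee>\<^bsub>top_mv\<^esub> top_hom y"
proof (cases "x \<in> top_comp \<or> y \<in> top_comp")
  case True
  have "x \<curlyvee> y = x" if "x \<in> top_comp" "y \<notin> top_comp"
    using below_top_comp [OF that(1) _ that(2)] by (simp add: rl_le_iff_join join_comm [of x])
  moreover have "x \<curlyvee> y = y" if "y \<in> top_comp" "x \<notin> top_comp"
    using below_top_comp [OF that(1) _ that(2)] by (simp add: rl_le_iff_join)
  ultimately show ?thesis using True
    by (auto simp: top_hom_def top_mv_def)
next
  case False
  have "x \<curlyvee> y \<preceq> w" if "w \<in> top_comp" for w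
    using False that by (intro join_least below_top_comp) auto
  note le = this
  \<comment> \<open>A join of two elements outside may enter the component, but only as its least
    element, which is the zero of the chain.\<close>
  have "\<not> top_unbounded \<and> x \<curlyvee> y = top_least" if mem: "x \<curlyvee> y \<in> top_comp"
  proof -
    have nu: "\<not> top_unbounded" using le mem by (auto simp: top_unbounded_def)
    with top_least [OF nu] le mem have "x \<curlyvee> y = top_least" by (intro rl_le_antisym) auto
    with nu show ?thesis by simp
  qed
  then show ?thesis using False
    by (auto simp: top_hom_def top_mv_def top_least)
qed

text \<open>An implication other than 1 with value in the component has both arguments there; the
  value 1 is a matter of monotonicity. The restriction is essential: if \<open>x\<close>,
  \<open>y\<close> and \<open>x \<leadsto> y\<close> all lie outside, the left side is 0 and the
  right side is 1. This is the defect that \<open>G\<close> repairs.\<close>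

lemma top_hom_imp:
  assumes [simp]: "x \<in> carrier A" "y \<in> carrier A" and xy: "x \<leadsto> y \<in> top_comp"
  shows "top_hom (x \<leadsto> y) = top_hom x \<leadsto>\<^bsub>top_mv\<^esub> top_hom y"
proof (cases "x \<leadsto> y = \<one>")
  case True
  interpret M: gbl_algebra top_mv by (rule top_mv_gbl)
  have "x \<curlywedge> y = x" using True by (simp flip: rl_le_iff_imp add: rl_le_def)
  then have "top_hom x \<preceq>\<^bsub>top_mv\<^esub> top_hom y" unfolding rl_le_def by (simp flip: top_hom_meet)
  then show ?thesis by (simp add: True top_hom_one M.rl_le_iff_imp top_hom_closed)
next
  case False
  then show ?thesis using top_comp_of_imp [OF xy False] xy by (simp add: top_hom_def top_mv_def)
qed

lemma top_hom_c: "top_hom c \<noteq> \<one>\<^bsub>top_mv\<^esub>"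
  using c_neq_one c_top_comp by (auto simp: top_hom_def top_mv_def)

end


section \<open>Lindenbaum algebras\<close>


text \<open>The base and the modal calculi have different formula types and rules. Their common part
  is isolated here, with the premises absorbed in \<open>D\<close>, so that the Lindenbaum
  construction is carried out once.\<close>

locale hilbert_gbl =
  fixes D :: "'f \<Rightarrow> bool" and zer one :: 'f and con dis fus imp :: "'f \<Rightarrow> 'f \<Rightarrow> 'f"
  assumes one: "D one"
    and A1: "D (imp a a)"
    and A2: "D (imp (imp a b) (imp (imp b d) (imp a d)))"
    and A3: "D (imp (fus a b) (fus b a))"
    and A4: "D (imp (fus a b) b)"
    and A5: "D (imp (imp a (imp b d)) (imp (fus a b) d))"
    and A6: "D (imp (imp (fus a b) d) (imp a (imp b d)))"
    and A7: "D (imp (fus a (imp a b)) (con a b))"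
    and A8: "D (imp (con a b) (fus a (imp a b)))"
    and A9: "D (imp (con a b) (con b a))"
    and A10: "D (imp a (dis a b))"
    and A11: "D (imp b (dis a b))"
    and A12: "D (imp (con (imp a b) (imp d b)) (imp (dis a d) b))"
    and A13: "D (imp zer a)"
    and MP: "D a \<Longrightarrow> D (imp a b) \<Longrightarrow> D b"
begin

abbreviation le (infix "\<lesssim>" 50) where "a \<lesssim> b \<equiv> D (imp a b)"

lemma le_trans: "a \<lesssim> b \<Longrightarrow> b \<lesssim> d \<Longrightarrow> a \<lesssim> d"
  using A2 MP by blast

lemma fus_le_iff: "fus a b \<lesssim> d \<longleftrightarrow> a \<lesssim> imp b d"
  using A5 A6 MP by blast

lemma fus_le_iff': "fus a b \<lesssim> d \<longleftrightarrow> b \<lesssim> imp a d"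
  using A3 le_trans fus_le_iff by blast

lemma fus_le1: "fus a b \<lesssim> a"
  using A3 A4 le_trans by blast

lemma weaken: "D a \<Longrightarrow> b \<lesssim> a"
  using fus_le1 fus_le_iff MP by blast

lemma derivable_iff: "D a \<longleftrightarrow> one \<lesssim> a"
  using weaken one MP by blast

lemma fus_mono: "a \<lesssim> a' \<Longrightarrow> b \<lesssim> b' \<Longrightarrow> fus a b \<lesssim> fus a' b'"
  using fus_le_iff fus_le_iff' A1 le_trans by meson

lemma imp_mono: "a' \<lesssim> a \<Longrightarrow> b \<lesssim> b' \<Longrightarrow> imp a b \<lesssim> imp a' b'"
  using fus_le_iff fus_mono A1 le_trans by meson

lemma fus_assoc: "fus (fus a b) d \<lesssim> fus a (fus b d)" "fus a (fus b d) \<lesssim> fus (fus a b) d"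
proof -
  have *: "fus (fus a b) d \<lesssim> fus a (fus b d)" for a b d
  proof -
    have "a \<lesssim> imp (fus b d) (fus a (fus b d))" using fus_le_iff A1 by blast
    then have "a \<lesssim> imp b (imp d (fus a (fus b d)))" using A6 le_trans by blast
    then show ?thesis using fus_le_iff by blast
  qed
  show "fus (fus a b) d \<lesssim> fus a (fus b d)" by (rule *)
  have "fus a (fus b d) \<lesssim> fus (fus d b) a"
    using A3 fus_mono A1 le_trans by meson
  also have "fus (fus d b) a \<lesssim> fus d (fus b a)" by (rule *)
  also (le_trans) have "fus d (fus b a) \<lesssim> fus (fus a b) d"
    using A3 fus_mono A1 le_trans by meson
  finally (le_trans) show "fus a (fus b d) \<lesssim> fus (fus a b) d" .
qed

lemma one_fus: "fus one a \<lesssim> a" "a \<lesssim> fus one a"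
proof -
  show "fus one a \<lesssim> a" by (rule A4)
  have "one \<lesssim> imp a (fus one a)" using fus_le_iff A1 by blast
  then show "a \<lesssim> fus one a" using one MP by blast
qed

lemma con_le1: "con a b \<lesssim> a"
  using A8 fus_le1 le_trans by blast

lemma con_le2: "con a b \<lesssim> b"
  using A9 con_le1 le_trans by blast

text \<open>No axiom introduces a conjunction directly. It is reached through divisibility, along
  \<open>d\<close>, \<open>fus d (imp d a)\<close>, \<open>con d a\<close>, \<open>con a d\<close>,
  \<open>fus a (imp a d)\<close>, \<open>fus a (imp a b)\<close>, \<open>con a b\<close>.\<close>

lemma le_con:
  assumes "d \<lesssim> a" "d \<lesssim> b"
  shows "d \<lesssim> con a b"
proof -
  have "imp d a \<lesssim> imp d (fus d (imp d a))" using fus_le_iff' A1 by blast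
  then have "d \<lesssim> fus d (imp d a)" using assms(1) MP by blast
  then have "d \<lesssim> con d a" using A7 le_trans by blast
  then have "d \<lesssim> fus a (imp a d)" using A8 A9 le_trans by blast
  moreover have "fus a (imp a d) \<lesssim> fus a (imp a b)" using assms(2) fus_mono imp_mono A1 by blast
  ultimately show ?thesis using A7 le_trans by blast
qed

lemma derivable_con_iff: "D (con a b) \<longleftrightarrow> D a \<and> D b"
  using le_con derivable_iff con_le1 con_le2 MP by metis

lemma dis_le: "a \<lesssim> d \<Longrightarrow> b \<lesssim> d \<Longrightarrow> dis a b \<lesssim> d"
  using A12 derivable_con_iff MP by blast

lemma con_mono: "a \<lesssim> a' \<Longrightarrow> b \<lesssim> b' \<Longrightarrow> con a b \<lesssim> con a' b'"
  using le_con con_le1 con_le2 le_trans by meson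

lemma dis_mono: "a \<lesssim> a' \<Longrightarrow> b \<lesssim> b' \<Longrightarrow> dis a b \<lesssim> dis a' b'"
  using dis_le A10 A11 le_trans by meson

end

text \<open>The quotient map is any map whose kernel is interderivability: completeness needs its
  values in a prescribed infinite type, while the canonical algebra uses the classes
  themselves.\<close>

locale hilbert_gbl_quotient = hilbert_gbl D for D :: "'f \<Rightarrow> bool" +
  fixes q :: "'f \<Rightarrow> 'a"
  assumes q_eq_iff: "q a = q b \<longleftrightarrow> a \<lesssim> b \<and> b \<lesssim> a"
begin

lemma le_inv_q: "a \<lesssim> inv_into UNIV q (q a)" "inv_into UNIV q (q a) \<lesssim> a"
  using q_eq_iff [of a "inv_into UNIV q (q a)"] f_inv_into_f [of "q a" q UNIV] by auto

lemma q_inv_q: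
  "q (fus (inv_into UNIV q (q a)) (inv_into UNIV q (q b))) = q (fus a b)"
  "q (imp (inv_into UNIV q (q a)) (inv_into UNIV q (q b))) = q (imp a b)"
  "q (con (inv_into UNIV q (q a)) (inv_into UNIV q (q b))) = q (con a b)"
  "q (dis (inv_into UNIV q (q a)) (inv_into UNIV q (q b))) = q (dis a b)"
  using le_inv_q fus_mono imp_mono con_mono dis_mono unfolding q_eq_iff by meson+

lemma q_eq_one_iff: "q a = q one \<longleftrightarrow> D a"
  using q_eq_iff derivable_iff weaken one by blast

lemma quotient_gbl:
  fixes A :: "('a, 'm) rl_scheme"
  assumes "carrier A = range q" "\<one>\<^bsub>A\<^esub> = q one" "\<zero>\<^bsub>A\<^esub> = q zer"
    "\<And>a b. q a \<otimes>\<^bsub>A\<^esub> q b = q (fus a b)"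
    "\<And>a b. q a \<leadsto>\<^bsub>A\<^esub> q b = q (imp a b)"
    "\<And>a b. q a \<curlywedge>\<^bsub>A\<^esub> q b = q (con a b)"
    "\<And>a b. q a \<curlyvee>\<^bsub>A\<^esub> q b = q (dis a b)"
  shows "gbl_algebra A" "q a \<preceq>\<^bsub>A\<^esub> q b \<longleftrightarrow> a \<lesssim> b"
proof -
  define less_eq where "less_eq x y \<longleftrightarrow> inv_into UNIV q x \<lesssim> inv_into UNIV q y" for x y
  have le: "less_eq (q a) (q b) \<longleftrightarrow> a \<lesssim> b" for a b
    unfolding less_eq_def using le_inv_q le_trans by meson
  show "gbl_algebra A"
    by (rule gbl_algebraI [of _ less_eq])
      (auto simp: assms le q_eq_iff A1 A4 A8 A10 A11 A13 con_le1 con_le2 le_con dis_le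
        fus_assoc [unfolded fus_le_iff] A3 [unfolded fus_le_iff] A7 [unfolded fus_le_iff]
        one_fus fus_le_iff weaken one rangeI intro: le_trans)
  show "q a \<preceq>\<^bsub>A\<^esub> q b \<longleftrightarrow> a \<lesssim> b"
    by (auto simp: rl_le_def assms q_eq_iff intro: con_le1 le_con A1 dest: le_trans [OF _ con_le2])
qed

end


section \<open>Generalized basic logic\<close>


context gbl_algebra
begin

lemma gbl_identities2:
  assumes [simp]: "a \<in> carrier A" "b \<in> carrier A"
  shows "(a \<otimes> b) \<leadsto> (b \<otimes> a) = \<one>"
    "(a \<otimes> b) \<leadsto> b = \<one>"
    "(a \<otimes> (a \<leadsto> b)) \<leadsto> (a \<curlywedge> b) = \<one>"
    "(a \<curlywedge> b) \<leadsto> (a \<otimes> (a \<leadsto> b)) = \<one>"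
    "(a \<curlywedge> b) \<leadsto> (b \<curlywedge> a) = \<one>"
    "a \<leadsto> (a \<curlyvee> b) = \<one>"
    "b \<leadsto> (a \<curlyvee> b) = \<one>"
  by (simp_all add: m_comm meet_comm divisibility flip: rl_le_iff_imp)

lemma gbl_identities3:
  assumes [simp]: "a \<in> carrier A" "b \<in> carrier A" "d \<in> carrier A"
  shows "(a \<leadsto> b) \<leadsto> ((b \<leadsto> d) \<leadsto> (a \<leadsto> d)) = \<one>"
    "(a \<leadsto> (b \<leadsto> d)) \<leadsto> ((a \<otimes> b) \<leadsto> d) = \<one>"
    "((a \<otimes> b) \<leadsto> d) \<leadsto> (a \<leadsto> (b \<leadsto> d)) = \<one>"
    "((a \<leadsto> b) \<curlywedge> (d \<leadsto> b)) \<leadsto> ((a \<curlyvee> d) \<leadsto> b) = \<one>"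
proof -
  have "b \<preceq> (b \<leadsto> d) \<leadsto> d" by simp
  then have "a \<leadsto> b \<preceq> a \<leadsto> ((b \<leadsto> d) \<leadsto> d)" by (intro imp_mono) auto
  then show "(a \<leadsto> b) \<leadsto> ((b \<leadsto> d) \<leadsto> (a \<leadsto> d)) = \<one>"
    by (simp add: rl_le_iff_imp imp_exchange [of a])
  show "(a \<leadsto> (b \<leadsto> d)) \<leadsto> ((a \<otimes> b) \<leadsto> d) = \<one>" "((a \<otimes> b) \<leadsto> d) \<leadsto> (a \<leadsto> (b \<leadsto> d)) = \<one>"
    by (simp_all add: imp_imp)
  let ?m = "(a \<leadsto> b) \<curlywedge> (d \<leadsto> b)"
  have "a \<preceq> ?m \<leadsto> b"
  proof -
    have "?m \<otimes> a \<preceq> b" by (simp add: residuation)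
    then show ?thesis by (simp flip: residuation add: m_comm)
  qed
  moreover have "d \<preceq> ?m \<leadsto> b"
  proof -
    have "?m \<otimes> d \<preceq> b" by (simp add: residuation)
    then show ?thesis by (simp flip: residuation add: m_comm)
  qed
  ultimately have "a \<curlyvee> d \<preceq> ?m \<leadsto> b" by (intro join_least) auto
  then have "?m \<preceq> (a \<curlyvee> d) \<leadsto> b" by (simp flip: residuation add: m_comm)
  then show "?m \<leadsto> ((a \<curlyvee> d) \<leadsto> b) = \<one>" by (simp add: rl_le_iff_imp)
qed

end

lemma eval_closed:
  assumes "gbl_algebra A" "range v \<subseteq> carrier A"
  shows "eval A v \<phi> \<in> carrier A"
proof -
  interpret gbl_algebra A by fact
  show ?thesis using assms(2) by (induction \<phi>) auto
qed

lemma gbl_sound: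
  assumes "gbl_algebra A" "range v \<subseteq> carrier A" "\<And>\<psi>. \<psi> \<in> \<Gamma> \<Longrightarrow> eval A v \<psi> = \<one>\<^bsub>A\<^esub>"
    and "\<Gamma> \<turnstile>\<^sub>G\<^sub>B\<^sub>L \<phi>"
  shows "eval A v \<phi> = \<one>\<^bsub>A\<^esub>"
  using assms(4)
proof induction
  interpret gbl_algebra A by fact
  note [simp] = eval_closed [OF assms(1,2)]
  case (axiom \<phi>)
  then show ?case by cases (simp_all add: gbl_identities2 gbl_identities3)
next
  interpret gbl_algebra A by fact
  note [simp] = eval_closed [OF assms(1,2)]
  case (MP \<phi> \<psi>)
  then show ?case by simp
qed (use assms(3) in auto)

section \<open>Local deduction theorem and completeness\<close>

lemma hilbert_gbl_fm: "hilbert_gbl (gbl_derives \<Gamma>) Zero One Conj Disj Fus Imp"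
  by unfold_locales (auto intro: gbl_derives.axiom gbl_axioms.intros gbl_derives.MP)

definition fm_quotient :: "(fm \<Rightarrow> 'a) \<Rightarrow> 'a rl" where
  "fm_quotient q = \<lparr>
    carrier = range q,
    mult = (\<lambda>x y. q (Fus (inv_into UNIV q x) (inv_into UNIV q y))),
    one = q One,
    rl_meet = (\<lambda>x y. q (Conj (inv_into UNIV q x) (inv_into UNIV q y))),
    rl_join = (\<lambda>x y. q (Disj (inv_into UNIV q x) (inv_into UNIV q y))),
    rl_imp = (\<lambda>x y. q (Imp (inv_into UNIV q x) (inv_into UNIV q y))),
    rl_zero = q Zero\<rparr>"

locale gbl_lindenbaum =
  fixes \<Gamma> :: "fm set" and q :: "fm \<Rightarrow> 'a"
  assumes fm_q_eq_iff: "q \<phi> = q \<psi> \<longleftrightarrow> \<Gamma> \<turnstile>\<^sub>G\<^sub>B\<^sub>L Imp \<phi> \<psi> \<and> \<Gamma> \<turnstile>\<^sub>G\<^sub>B\<^sub>L Imp \<psi> \<phi>"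
begin

sublocale hilbert_gbl_quotient Zero One Conj Disj Fus Imp "gbl_derives \<Gamma>" q
  by (intro hilbert_gbl_quotient.intro hilbert_gbl_fm hilbert_gbl_quotient_axioms.intro fm_q_eq_iff)

lemma fm_quotient_simps:
  "carrier (fm_quotient q) = range q" "\<one>\<^bsub>fm_quotient q\<^esub> = q One" "\<zero>\<^bsub>fm_quotient q\<^esub> = q Zero"
  "q \<phi> \<otimes>\<^bsub>fm_quotient q\<^esub> q \<psi> = q (Fus \<phi> \<psi>)"
  "q \<phi> \<leadsto>\<^bsub>fm_quotient q\<^esub> q \<psi> = q (Imp \<phi> \<psi>)"
  "q \<phi> \<curlywedge>\<^bsub>fm_quotient q\<^esub> q \<psi> = q (Conj \<phi> \<psi>)"
  "q \<phi> \<curlyvee>\<^bsub>fm_quotient q\<^esub> q \<psi> = q (Disj \<phi> \<psi>)"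
  by (simp_all add: fm_quotient_def q_inv_q)

lemma fm_quotient_gbl: "gbl_algebra (fm_quotient q)"
  and fm_quotient_le: "q \<phi> \<preceq>\<^bsub>fm_quotient q\<^esub> q \<psi> \<longleftrightarrow> \<Gamma> \<turnstile>\<^sub>G\<^sub>B\<^sub>L Imp \<phi> \<psi>"
  by (rule quotient_gbl; rule fm_quotient_simps)+

lemma eval_fm_quotient: "eval (fm_quotient q) (\<lambda>p. q (Var p)) \<phi> = q \<phi>"
  by (induction \<phi>) (simp_all add: fm_quotient_simps)

lemma local_deduction:
  assumes "insert \<phi> \<Gamma> \<turnstile>\<^sub>G\<^sub>B\<^sub>L \<psi>"
  shows "\<exists>n::nat. q \<phi> [^]\<^bsub>fm_quotient q\<^esub> n \<preceq>\<^bsub>fm_quotient q\<^esub> q \<psi>"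
proof -
  interpret Q: gbl_algebra "fm_quotient q" by (rule fm_quotient_gbl)
  have [simp]: "q \<chi> \<in> carrier (fm_quotient q)" for \<chi> by (simp add: fm_quotient_simps)
  have trivial: "\<exists>n::nat. q \<phi> [^]\<^bsub>fm_quotient q\<^esub> n \<preceq>\<^bsub>fm_quotient q\<^esub> q \<chi>" if "\<Gamma> \<turnstile>\<^sub>G\<^sub>B\<^sub>L \<chi>" for \<chi>
  proof -
    have "q \<chi> = \<one>\<^bsub>fm_quotient q\<^esub>" using that by (simp add: q_eq_one_iff fm_quotient_simps)
    then show ?thesis by simp
  qed
  show ?thesis using assms
  proof induction
    case (axiom \<chi>)
    then show ?case by (intro trivial gbl_derives.axiom)
  next
    case (premise \<chi>)
    show ?case
    proof (cases "\<chi> = \<phi>")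
      case True
      then show ?thesis by (intro exI [of _ 1]) simp
    next
      case False
      then show ?thesis using premise by (intro trivial gbl_derives.premise) auto
    qed
  next
    case (MP \<chi> \<psi>)
    then obtain m n :: nat where
      "q \<phi> [^]\<^bsub>fm_quotient q\<^esub> m \<preceq>\<^bsub>fm_quotient q\<^esub> q \<chi>"
      "q \<phi> [^]\<^bsub>fm_quotient q\<^esub> n \<preceq>\<^bsub>fm_quotient q\<^esub> q \<chi> \<leadsto>\<^bsub>fm_quotient q\<^esub> q \<psi>"
      by (auto simp: fm_quotient_simps)
    then have "q \<phi> [^]\<^bsub>fm_quotient q\<^esub> (m + n) \<preceq>\<^bsub>fm_quotient q\<^esub>
        q \<chi> \<otimes>\<^bsub>fm_quotient q\<^esub> (q \<chi> \<leadsto>\<^bsub>fm_quotient q\<^esub> q \<psi>)"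
      by (simp flip: Q.nat_pow_mult add: Q.mult_mono)
    then have "q \<phi> [^]\<^bsub>fm_quotient q\<^esub> (m + n) \<preceq>\<^bsub>fm_quotient q\<^esub> q \<psi>"
      by (rule Q.rl_le_trans) simp_all
    then show ?case by blast
  qed
qed

end

text \<open>Countably many classes can be injected into any infinite type through chosen
  representatives. This is why the choice of the infinite carrier type does not matter.\<close>

lemma ex_quotient_map:
  fixes R :: "'f::countable \<Rightarrow> 'f \<Rightarrow> bool"
  assumes "infinite (UNIV :: 'a set)" "equivp R"
  shows "\<exists>q :: 'f \<Rightarrow> 'a. \<forall>x y. q x = q y \<longleftrightarrow> R x y"
proof -
  obtain e :: "nat \<Rightarrow> 'a" where e: "inj e"
    using infinite_countable_subset [OF assms(1)] by blast
  define rep where "rep x = (SOME z. R x z)" for x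
  have rep: "R x (rep x)" for x
    unfolding rep_def using someI [of "R x" x] assms(2) by (simp add: equivp_reflp)
  have "rep x = rep y \<longleftrightarrow> R x y" for x y
  proof
    assume "rep x = rep y"
    then show "R x y" using rep [of x] rep [of y] assms(2) by (metis equivp_symp equivp_transp)
  next
    assume "R x y"
    then have "R x = R y" using assms(2) by (simp add: equivp_def)
    then show "rep x = rep y" by (simp add: rep_def)
  qed
  then have "\<forall>x y. e (to_nat (rep x)) = e (to_nat (rep y)) \<longleftrightarrow> R x y"
    using e by (simp add: inj_eq)
  then show ?thesis by (intro exI [of _ "\<lambda>x. e (to_nat (rep x))"]) simp
qed

lemma (in hilbert_gbl) equivp_equivalent: "equivp (\<lambda>a b. a \<lesssim> b \<and> b \<lesssim> a)"
  by (rule equivpI) (auto simp: reflp_def symp_def transp_def A1 intro: le_trans)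

instance fm :: countable
  by countable_datatype

lemma gbl_complete:
  assumes "infinite (UNIV :: 'a set)"
  shows "eq_conseq (GBL :: 'a rl set) {(\<psi>, One) |\<psi>. \<psi> \<in> \<Gamma>} (\<phi>, One) \<longleftrightarrow> \<Gamma> \<turnstile>\<^sub>G\<^sub>B\<^sub>L \<phi>"
proof
  assume "\<Gamma> \<turnstile>\<^sub>G\<^sub>B\<^sub>L \<phi>"
  then show "eq_conseq (GBL :: 'a rl set) {(\<psi>, One) |\<psi>. \<psi> \<in> \<Gamma>} (\<phi>, One)"
    unfolding eq_conseq_def GBL_def by (auto intro: gbl_sound)
next
  assume L: "eq_conseq (GBL :: 'a rl set) {(\<psi>, One) |\<psi>. \<psi> \<in> \<Gamma>} (\<phi>, One)"
  interpret H: hilbert_gbl "gbl_derives \<Gamma>" Zero One Conj Disj Fus Imp by (rule hilbert_gbl_fm)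
  obtain q :: "fm \<Rightarrow> 'a" where "\<forall>x y. q x = q y \<longleftrightarrow> \<Gamma> \<turnstile>\<^sub>G\<^sub>B\<^sub>L Imp x y \<and> \<Gamma> \<turnstile>\<^sub>G\<^sub>B\<^sub>L Imp y x"
    using ex_quotient_map [OF assms H.equivp_equivalent] by blast
  then interpret gbl_lindenbaum \<Gamma> q by unfold_locales auto
  have "range (\<lambda>p. q (Var p)) \<subseteq> range q" by blast
  then have "eval (fm_quotient q) (\<lambda>p. q (Var p)) \<phi> = eval (fm_quotient q) (\<lambda>p. q (Var p)) One"
    using L [unfolded eq_conseq_def, rule_format, of "fm_quotient q" "\<lambda>p. q (Var p)"] fm_quotient_gbl
    by (auto simp: GBL_def fm_quotient_simps(1) eval_fm_quotient q_eq_one_iff gbl_derives.premise)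
  then show "\<Gamma> \<turnstile>\<^sub>G\<^sub>B\<^sub>L \<phi>" by (simp only: eval_fm_quotient q_eq_one_iff)
qed

section \<open>Maximal theories and their subdirectly irreducible quotients\<close>

lemma gbl_derives_mono: "\<Gamma> \<turnstile>\<^sub>G\<^sub>B\<^sub>L \<phi> \<Longrightarrow> \<Gamma> \<subseteq> \<Delta> \<Longrightarrow> \<Delta> \<turnstile>\<^sub>G\<^sub>B\<^sub>L \<phi>"
  by (induction rule: gbl_derives.induct) (auto intro: gbl_derives.intros)

lemma gbl_derives_finite: "\<Gamma> \<turnstile>\<^sub>G\<^sub>B\<^sub>L \<phi> \<Longrightarrow> \<exists>F. finite F \<and> F \<subseteq> \<Gamma> \<and> F \<turnstile>\<^sub>G\<^sub>B\<^sub>L \<phi>"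
proof (induction rule: gbl_derives.induct)
  case (axiom \<phi>)
  then show ?case by (intro exI [of _ "{}"]) (auto intro: gbl_derives.intros)
next
  case (premise \<phi>)
  then show ?case by (intro exI [of _ "{\<phi>}"]) (auto intro: gbl_derives.intros)
next
  case (MP \<phi> \<psi>)
  then obtain F F' where F: "finite F" "F \<subseteq> \<Gamma>" "F \<turnstile>\<^sub>G\<^sub>B\<^sub>L \<phi>" "finite F'" "F' \<subseteq> \<Gamma>" "F' \<turnstile>\<^sub>G\<^sub>B\<^sub>L Imp \<phi> \<psi>"
    by blast
  then have "F \<union> F' \<turnstile>\<^sub>G\<^sub>B\<^sub>L \<psi>"
    by (meson gbl_derives.MP gbl_derives_mono sup_ge1 sup_ge2)
  with F show ?case by (intro exI [of _ "F \<union> F'"]) auto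
qed

text \<open>These are the completely meet-irreducible theories: every proper extension derives the
  witness \<chi>.\<close>

definition maximal_avoiding :: "fm \<Rightarrow> fm set \<Rightarrow> bool" where
  "maximal_avoiding \<chi> T \<longleftrightarrow> \<not> T \<turnstile>\<^sub>G\<^sub>B\<^sub>L \<chi> \<and> (\<forall>\<phi>. \<phi> \<notin> T \<longrightarrow> insert \<phi> T \<turnstile>\<^sub>G\<^sub>B\<^sub>L \<chi>)"

lemma ex_maximal_avoiding:
  assumes "\<not> \<Gamma> \<turnstile>\<^sub>G\<^sub>B\<^sub>L \<chi>"
  shows "\<exists>T. \<Gamma> \<subseteq> T \<and> maximal_avoiding \<chi> T"
proof -
  let ?\<A> = "{T. \<Gamma> \<subseteq> T \<and> \<not> T \<turnstile>\<^sub>G\<^sub>B\<^sub>L \<chi>}"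
  have "\<exists>M\<in>?\<A>. \<forall>X\<in>?\<A>. M \<subseteq> X \<longrightarrow> X = M"
  proof (rule subset_Zorn_nonempty)
    show "?\<A> \<noteq> {}" using assms by blast
    fix \<C> assume \<C>: "\<C> \<noteq> {}" "subset.chain ?\<A> \<C>"
    \<comment> \<open>A derivation from the union uses finitely many premises, and these lie in one
      member of the chain.\<close>
    have "\<not> \<Union>\<C> \<turnstile>\<^sub>G\<^sub>B\<^sub>L \<chi>"
    proof
      assume "\<Union>\<C> \<turnstile>\<^sub>G\<^sub>B\<^sub>L \<chi>"
      then obtain F where F: "finite F" "F \<subseteq> \<Union>\<C>" "F \<turnstile>\<^sub>G\<^sub>B\<^sub>L \<chi>" using gbl_derives_finite by blast
      then obtain T where T: "T \<in> \<C>" "F \<subseteq> T" using finite_subset_Union_chain [OF F(1,2) \<C>] by blast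
      have "T \<turnstile>\<^sub>G\<^sub>B\<^sub>L \<chi>" by (rule gbl_derives_mono [OF F(3) T(2)])
      then show False using T(1) \<C>(2) unfolding subset.chain_def by blast
    qed
    then show "\<Union>\<C> \<in> ?\<A>" using \<C> unfolding subset.chain_def by blast
  qed
  then obtain M where M: "\<Gamma> \<subseteq> M" "\<not> M \<turnstile>\<^sub>G\<^sub>B\<^sub>L \<chi>"
    "\<And>X. \<Gamma> \<subseteq> X \<Longrightarrow> \<not> X \<turnstile>\<^sub>G\<^sub>B\<^sub>L \<chi> \<Longrightarrow> M \<subseteq> X \<Longrightarrow> X = M" by auto
  have "maximal_avoiding \<chi> M" unfolding maximal_avoiding_def
  proof (intro conjI allI impI)
    fix \<phi> assume "\<phi> \<notin> M"
    then show "insert \<phi> M \<turnstile>\<^sub>G\<^sub>B\<^sub>L \<chi>" using M(1) M(3) [of "insert \<phi> M"] by blast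
  qed (rule M(2))
  then show ?thesis using M(1) by blast
qed

definition fm_class :: "fm set \<Rightarrow> fm \<Rightarrow> fm set" where
  "fm_class T \<phi> = {\<psi>. T \<turnstile>\<^sub>G\<^sub>B\<^sub>L Imp \<phi> \<psi> \<and> T \<turnstile>\<^sub>G\<^sub>B\<^sub>L Imp \<psi> \<phi>}"

lemma gbl_lindenbaum_fm_class: "gbl_lindenbaum T (fm_class T)"
proof
  interpret H: hilbert_gbl "gbl_derives T" Zero One Conj Disj Fus Imp by (rule hilbert_gbl_fm)
  show "fm_class T \<phi> = fm_class T \<psi> \<longleftrightarrow> T \<turnstile>\<^sub>G\<^sub>B\<^sub>L Imp \<phi> \<psi> \<and> T \<turnstile>\<^sub>G\<^sub>B\<^sub>L Imp \<psi> \<phi>" for \<phi> \<psi>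
    unfolding fm_class_def using H.A1 H.le_trans by blast
qed

text \<open>A class other than 1 belongs to an underivable \<phi>. By maximality \<phi> together
  with \<open>T\<close> derives \<chi>, and local deduction turns this into a power of the class of
  \<phi> below that of \<chi>.\<close>

lemma si_fm_quotient:
  assumes "maximal_avoiding \<chi> T"
  shows "si_gbl_algebra (fm_quotient (fm_class T)) (fm_class T \<chi>)"
proof -
  interpret gbl_lindenbaum T "fm_class T" by (rule gbl_lindenbaum_fm_class)
  interpret Q: gbl_algebra "fm_quotient (fm_class T)" by (rule fm_quotient_gbl)
  show ?thesis
  proof
    show "fm_class T \<chi> \<in> carrier (fm_quotient (fm_class T))" by (simp add: fm_quotient_simps)
    show "fm_class T \<chi> \<noteq> \<one>\<^bsub>fm_quotient (fm_class T)\<^esub>"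
      using assms by (simp add: fm_quotient_simps q_eq_one_iff maximal_avoiding_def)
    fix x assume "x \<in> carrier (fm_quotient (fm_class T))" "x \<noteq> \<one>\<^bsub>fm_quotient (fm_class T)\<^esub>"
    then obtain \<phi> where \<phi>: "x = fm_class T \<phi>" "fm_class T \<phi> \<noteq> fm_class T One"
      unfolding fm_quotient_simps(1,2) by blast
    then have "\<not> T \<turnstile>\<^sub>G\<^sub>B\<^sub>L \<phi>" by (simp add: q_eq_one_iff)
    then have "insert \<phi> T \<turnstile>\<^sub>G\<^sub>B\<^sub>L \<chi>"
      using assms gbl_derives.premise by (auto simp: maximal_avoiding_def)
    then show "\<exists>n::nat. x [^]\<^bsub>fm_quotient (fm_class T)\<^esub> n \<preceq>\<^bsub>fm_quotient (fm_class T)\<^esub> fm_class T \<chi>"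
      unfolding \<phi>(1) by (rule local_deduction)
  qed
qed


section \<open>Soundness of the modal logics and of the translation\<close>

lemma rl_endoD:
  assumes "rl_endo A f"
  shows "x \<in> carrier A \<Longrightarrow> f x \<in> carrier A"
    "x \<in> carrier A \<Longrightarrow> y \<in> carrier A \<Longrightarrow> f (x \<curlywedge>\<^bsub>A\<^esub> y) = f x \<curlywedge>\<^bsub>A\<^esub> f y"
    "x \<in> carrier A \<Longrightarrow> y \<in> carrier A \<Longrightarrow> f (x \<otimes>\<^bsub>A\<^esub> y) = f x \<otimes>\<^bsub>A\<^esub> f y"
    "f \<zero>\<^bsub>A\<^esub> = \<zero>\<^bsub>A\<^esub>" "f \<one>\<^bsub>A\<^esub> = \<one>\<^bsub>A\<^esub>"
  using assms by (auto simp: rl_endo_def)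

lemma interior_opD:
  assumes "interior_op A f"
  shows "x \<in> carrier A \<Longrightarrow> f x \<preceq>\<^bsub>A\<^esub> x"
    "x \<in> carrier A \<Longrightarrow> f (f x) = f x"
    "x \<preceq>\<^bsub>A\<^esub> y \<Longrightarrow> x \<in> carrier A \<Longrightarrow> y \<in> carrier A \<Longrightarrow> f x \<preceq>\<^bsub>A\<^esub> f y"
  using assms by (auto simp: interior_op_def)

definition open_rl :: "('a, 'm) rl_scheme \<Rightarrow> ('a \<Rightarrow> 'a) \<Rightarrow> 'a rl" where
  "open_rl A f = \<lparr>
    carrier = {x \<in> carrier A. f x = x},
    mult = mult A,
    one = one A,
    rl_meet = rl_meet A,
    rl_join = rl_join A,
    rl_imp = (\<lambda>x y. f (rl_imp A x y)),
    rl_zero = rl_zero A\<rparr>"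

text \<open>Joins of open elements are open by monotonicity, and \<open>f (y \<leadsto> z)\<close>
  is the largest open element below \<open>y \<leadsto> z\<close>. Divisibility survives because
  \<open>f\<close> is multiplicative: for open \<open>x\<close> the factor \<open>x\<close> can be
  moved under \<open>f\<close>, where divisibility of \<open>A\<close> applies.\<close>

lemma open_rl_gbl:
  fixes A :: "('a, 'm) rl_scheme" (structure)
  assumes "gbl_algebra A" and endo: "rl_endo A f" and int: "interior_op A f"
  shows "gbl_algebra (open_rl A f)"
proof -
  interpret gbl_algebra A by fact
  note f = rl_endoD [OF endo] interior_opD [OF int]
  have join_open: "f (x \<curlyvee> y) = x \<curlyvee> y"
    if "x \<in> carrier A" "y \<in> carrier A" "f x = x" "f y = y" for x y
  proof (rule rl_le_antisym)
    have "f x \<preceq> f (x \<curlyvee> y)" "f y \<preceq> f (x \<curlyvee> y)" by (rule f(8); use that in simp)+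
    then show "x \<curlyvee> y \<preceq> f (x \<curlyvee> y)" using that by (intro join_least) (auto intro: f)
  qed (use that in \<open>auto intro: f\<close>)
  have res: "x \<otimes> y \<preceq> z \<longleftrightarrow> x \<preceq> f (y \<leadsto> z)"
    if "x \<in> carrier A" "y \<in> carrier A" "z \<in> carrier A" "f x = x" for x y z
  proof
    assume "x \<otimes> y \<preceq> z"
    then have "x \<preceq> y \<leadsto> z" using that by (simp add: residuation)
    then have "f x \<preceq> f (y \<leadsto> z)" using that by (intro f) auto
    then show "x \<preceq> f (y \<leadsto> z)" using that by simp
  next
    assume "x \<preceq> f (y \<leadsto> z)"
    then have "x \<preceq> y \<leadsto> z" by (rule rl_le_trans) (use that in \<open>simp_all add: f\<close>)
    then show "x \<otimes> y \<preceq> z" using that by (simp add: residuation)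
  qed
  have divis: "x \<otimes> f (x \<leadsto> y) = x \<curlywedge> y"
    if "x \<in> carrier A" "y \<in> carrier A" "f x = x" "f y = y" for x y
  proof -
    have "x \<otimes> f (x \<leadsto> y) = f (x \<otimes> (x \<leadsto> y))" using that by (simp add: f)
    then show ?thesis using that by (simp add: divisibility f)
  qed
  show ?thesis
  proof (rule gbl_algebraI [of _ "\<lambda>x y. x \<preceq> y"], goal_cases)
    case (8 x y z) then show ?case by (simp add: open_rl_def rl_le_trans [of x y z])
  next
    case 9 then show ?case by (simp add: open_rl_def rl_le_antisym)
  next
    case 12 then show ?case by (simp add: open_rl_def meet_greatest)
  next
    case 15 then show ?case by (simp add: open_rl_def join_least)
  next
    case 19 then show ?case by (simp add: open_rl_def m_comm)
  qed (simp_all add: open_rl_def f join_open res divis zero_least m_assoc)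
qed

lemma eval_open_rl:
  "eval (open_rl A (rl_modal A b)) (\<lambda>p. rl_modal A b (v p)) \<phi> = modal_eval A v (translate b \<phi>)"
  by (induction \<phi>) (simp_all add: open_rl_def)

lemma translation_sound:
  assumes "gbl_algebra A" "rl_endo A (rl_modal A b)" "interior_op A (rl_modal A b)"
    and "range v \<subseteq> carrier A"
    and "\<And>\<psi>. \<psi> \<in> \<Gamma> \<Longrightarrow> modal_eval A v (translate b \<psi>) = \<one>\<^bsub>A\<^esub>"
    and "\<Gamma> \<turnstile>\<^sub>G\<^sub>B\<^sub>L \<phi>"
  shows "modal_eval A v (translate b \<phi>) = \<one>\<^bsub>A\<^esub>"
proof -
  let ?O = "open_rl A (rl_modal A b)" and ?v = "\<lambda>p. rl_modal A b (v p)"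
  have one: "\<one>\<^bsub>?O\<^esub> = \<one>\<^bsub>A\<^esub>" by (simp add: open_rl_def)
  have "range ?v \<subseteq> carrier ?O"
    using assms(4) rl_endoD(1) [OF assms(2)] interior_opD(2) [OF assms(3)]
    by (auto simp: open_rl_def)
  then have "eval ?O ?v \<phi> = \<one>\<^bsub>?O\<^esub>"
    by (rule gbl_sound [OF open_rl_gbl [OF assms(1-3)] _ _ assms(6)])
      (simp add: eval_open_rl one assms(5))
  then show ?thesis by (simp add: eval_open_rl one)
qed

section \<open>Soundness of the modal calculi\<close>

lemma modal_eval_closed:
  assumes "gbl_algebra A" "\<And>b. rl_endo A (rl_modal A b)" "range v \<subseteq> carrier A"
  shows "modal_eval A v \<phi> \<in> carrier A"
proof -
  interpret gbl_algebra A by fact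
  show ?thesis using assms(3) by (induction \<phi>) (auto intro: rl_endoD(1) [OF assms(2)])
qed

context mv_algebra
begin

lemma neg_closed [simp]: "x \<in> carrier A \<Longrightarrow> rl_neg A x \<in> carrier A"
  by (simp add: rl_neg_def)

lemma neg_antimono: "x \<preceq> y \<Longrightarrow> x \<in> carrier A \<Longrightarrow> y \<in> carrier A \<Longrightarrow> rl_neg A y \<preceq> rl_neg A x"
  unfolding rl_neg_def by (intro imp_mono) auto

lemma neg_le_swap: "rl_neg A x \<preceq> y \<Longrightarrow> x \<in> carrier A \<Longrightarrow> y \<in> carrier A \<Longrightarrow> rl_neg A y \<preceq> x"
  using neg_antimono [of "rl_neg A x" y] by (simp add: involution)

end

lemma modal_sound:
  assumes "mv_algebra A" and endo: "\<And>b. rl_endo A (rl_modal A b)" and v: "range v \<subseteq> carrier A"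
    and "\<And>\<psi>. \<psi> \<in> Ax \<Longrightarrow> modal_eval A v \<psi> = \<one>\<^bsub>A\<^esub>"
    and "\<And>\<psi>. \<psi> \<in> \<Gamma> \<Longrightarrow> modal_eval A v \<psi> = \<one>\<^bsub>A\<^esub>"
    and "modal_derives Ax \<Gamma> \<phi>"
  shows "modal_eval A v \<phi> = \<one>\<^bsub>A\<^esub>"
  using assms(6)
proof induction
  interpret mv_algebra A by fact
  note closed = modal_eval_closed [OF gbl_algebra_axioms endo v]
  case (MP \<phi> \<psi>)
  then show ?case using closed [of \<psi>] by simp
next
  case (Nec \<phi> b)
  then show ?case using rl_endoD(5) [OF endo] by simp
qed (use assms in auto)

lemma luk_axioms_valid:
  assumes "mv_algebra A" and endo: "\<And>b. rl_endo A (rl_modal A b)"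
    and mono: "\<And>b. interior_op A (rl_modal A b)" and v: "range v \<subseteq> carrier A"
    and "\<phi> \<in> luk_axioms"
  shows "modal_eval A v \<phi> = \<one>\<^bsub>A\<^esub>"
proof -
  interpret mv_algebra A by fact
  note [simp] = modal_eval_closed [OF gbl_algebra_axioms endo v]
  note f = rl_endoD [OF endo] interior_opD [OF mono]
  show ?thesis using assms(5)
  proof cases
    case (A15 \<psi>)
    then show ?thesis using involution [of "modal_eval A v \<psi>"] by (simp add: rl_neg_def)
  next
    case (K b \<psi> \<chi>)
    let ?x = "modal_eval A v \<psi>" and ?y = "modal_eval A v \<chi>" and ?f = "rl_modal A b"
    \<comment> \<open>Monotonicity is applied to the algebraic form of modus ponens; preservation of
      products then splits the left side.\<close>
    have "?f ((?x \<leadsto>\<^bsub>A\<^esub> ?y) \<otimes>\<^bsub>A\<^esub> ?x) \<preceq>\<^bsub>A\<^esub> ?f ?y" by (intro f) auto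
    then have "?f (?x \<leadsto>\<^bsub>A\<^esub> ?y) \<preceq>\<^bsub>A\<^esub> ?f ?x \<leadsto>\<^bsub>A\<^esub> ?f ?y" by (simp add: f flip: residuation)
    then show ?thesis using K by (simp add: rl_le_iff_imp f)
  qed (simp_all add: gbl_identities2 gbl_identities3 prelinearity f)
qed

lemma s4luk_axioms_valid:
  assumes "mv_algebra A" and endo: "\<And>b. rl_endo A (rl_modal A b)"
    and int: "\<And>b. interior_op A (rl_modal A b)" and v: "range v \<subseteq> carrier A"
    and "\<phi> \<in> s4luk_axioms"
  shows "modal_eval A v \<phi> = \<one>\<^bsub>A\<^esub>"
proof -
  interpret mv_algebra A by fact
  note [simp] = modal_eval_closed [OF gbl_algebra_axioms endo v]
  note f = rl_endoD [OF endo] interior_opD [OF int]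
  show ?thesis using assms(5)
  proof cases
    case luk
    then show ?thesis using assms by (intro luk_axioms_valid)
  qed (simp_all add: f flip: rl_le_iff_imp)
qed

lemma S4tMV_D:
  assumes "A \<in> S4tMV"
  shows "mv_algebra A" "rl_endo A (rl_modal A b)" "interior_op A (rl_modal A b)"
    "x \<in> carrier A \<Longrightarrow> y \<in> carrier A \<Longrightarrow>
      x \<preceq>\<^bsub>A\<^esub> rl_modal A G_op y \<longleftrightarrow> rl_neg A (rl_modal A H_op (rl_neg A x)) \<preceq>\<^bsub>A\<^esub> y"
  using assms by (auto simp: S4tMV_def)

lemma S4MV_D:
  assumes "A \<in> S4MV"
  shows "mv_algebra A" "rl_endo A (rl_modal A b)" "interior_op A (rl_modal A b)"
  using assms by (cases b; auto simp: S4MV_def)+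

lemma s4tluk_axioms_valid:
  assumes A: "A \<in> S4tMV" and v: "range v \<subseteq> carrier A" and "\<phi> \<in> s4tluk_axioms"
  shows "modal_eval A v \<phi> = \<one>\<^bsub>A\<^esub>"
proof -
  interpret mv_algebra A by (rule S4tMV_D [OF A])
  note [simp] = modal_eval_closed [OF gbl_algebra_axioms S4tMV_D(2) [OF A] v]
    rl_endoD(1) [OF S4tMV_D(2) [OF A]]
  note adj = S4tMV_D(4) [OF A]
  show ?thesis using assms(3)
  proof cases
    case s4luk
    then show ?thesis using S4tMV_D [OF A] v by (intro s4luk_axioms_valid)
  next
    case (GP \<psi>)
    let ?x = "modal_eval A v \<psi>"
    have "?x \<preceq>\<^bsub>A\<^esub> rl_modal A G_op (rl_neg A (rl_modal A H_op (rl_neg A ?x)))"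
      by (simp add: adj)
    then show ?thesis using GP by (simp add: rl_le_iff_imp rl_neg_def)
  next
    case (HF \<psi>)
    let ?x = "modal_eval A v \<psi>"
    let ?g = "rl_modal A G_op (rl_neg A ?x)"
    \<comment> \<open>Reflexivity at \<open>?g\<close> is the counit of the adjunction; contraposed
      by the involution it becomes HF, just as the unit is GP.\<close>
    have "rl_neg A (rl_modal A H_op (rl_neg A ?g)) \<preceq>\<^bsub>A\<^esub> rl_neg A ?x"
      by (simp flip: adj)
    then have "?x \<preceq>\<^bsub>A\<^esub> rl_modal A H_op (rl_neg A ?g)"
      using neg_le_swap [of "rl_modal A H_op (rl_neg A ?g)" "rl_neg A ?x"] by (simp add: involution)
    then show ?thesis using HF by (simp add: rl_le_iff_imp rl_neg_def)
  qed
qed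


section \<open>Completeness of the modal logics\<close>

lemma modal_eq_conseq_one_iff:
  "modal_eq_conseq K {(f \<psi>, MOne) |\<psi>. \<psi> \<in> \<Delta>} (\<phi>, MOne) \<longleftrightarrow>
    (\<forall>A\<in>K. \<forall>v. range v \<subseteq> carrier A \<longrightarrow>
      (\<forall>\<psi>\<in>\<Delta>. modal_eval A v (f \<psi>) = \<one>\<^bsub>A\<^esub>) \<longrightarrow> modal_eval A v \<phi> = \<one>\<^bsub>A\<^esub>)"
proof -
  have "(\<forall>(\<alpha>, \<beta>)\<in>{(f \<psi>, MOne) |\<psi>. \<psi> \<in> \<Delta>}. modal_eval A v \<alpha> = modal_eval A v \<beta>) \<longleftrightarrow>
      (\<forall>\<psi>\<in>\<Delta>. modal_eval A v (f \<psi>) = \<one>\<^bsub>A\<^esub>)" for A :: "('a, 'b) modal_rl" and v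
    by fastforce
  then show ?thesis by (simp add: modal_eq_conseq_def)
qed

lemma hilbert_gbl_mfm:
  assumes "luk_axioms \<subseteq> Ax"
  shows "hilbert_gbl (modal_derives Ax \<Gamma>) MZero MOne MConj MDisj MFus MImp"
proof -
  have "modal_derives Ax \<Gamma> \<phi>" if "\<phi> \<in> luk_axioms" for \<phi>
    using that assms by (auto intro: modal_derives.axiom)
  then show ?thesis by unfold_locales (auto intro: luk_axioms.intros modal_derives.MP)
qed

definition mfm_quotient :: "('i mfm \<Rightarrow> 'a) \<Rightarrow> ('a, 'i) modal_rl" where
  "mfm_quotient q = \<lparr>
    carrier = range q,
    mult = (\<lambda>x y. q (MFus (inv_into UNIV q x) (inv_into UNIV q y))),
    one = q MOne,
    rl_meet = (\<lambda>x y. q (MConj (inv_into UNIV q x) (inv_into UNIV q y))),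
    rl_join = (\<lambda>x y. q (MDisj (inv_into UNIV q x) (inv_into UNIV q y))),
    rl_imp = (\<lambda>x y. q (MImp (inv_into UNIV q x) (inv_into UNIV q y))),
    rl_zero = q MZero,
    rl_modal = (\<lambda>b x. q (Modal b (inv_into UNIV q x)))\<rparr>"

locale modal_lindenbaum =
  fixes Ax \<Gamma> :: "'i mfm set" and q :: "'i mfm \<Rightarrow> 'a"
  assumes s4luk_subset: "s4luk_axioms \<subseteq> Ax"
    and mfm_q_eq_iff: "q \<phi> = q \<psi> \<longleftrightarrow> modal_derives Ax \<Gamma> (MImp \<phi> \<psi>) \<and> modal_derives Ax \<Gamma> (MImp \<psi> \<phi>)"
begin

lemma s4luk_derivable: "\<phi> \<in> s4luk_axioms \<Longrightarrow> modal_derives Ax \<Gamma> \<phi>"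
  using s4luk_subset by (auto intro: modal_derives.axiom)

lemma luk_subset: "luk_axioms \<subseteq> Ax"
  using s4luk_subset by (auto intro: s4luk_axioms.luk)

lemma luk_derivable: "\<phi> \<in> luk_axioms \<Longrightarrow> modal_derives Ax \<Gamma> \<phi>"
  by (intro s4luk_derivable s4luk_axioms.luk)

sublocale hilbert_gbl_quotient MZero MOne MConj MDisj MFus MImp "modal_derives Ax \<Gamma>" q
  by (intro hilbert_gbl_quotient.intro hilbert_gbl_mfm hilbert_gbl_quotient_axioms.intro
      mfm_q_eq_iff luk_subset)

lemma modal_mono: "modal_derives Ax \<Gamma> (MImp \<phi> \<psi>) \<Longrightarrow> modal_derives Ax \<Gamma> (MImp (Modal b \<phi>) (Modal b \<psi>))"
  by (meson modal_derives.MP modal_derives.Nec luk_derivable luk_axioms.K)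

lemma iff_derivable: "MConj (MImp \<phi> \<psi>) (MImp \<psi> \<phi>) \<in> luk_axioms \<Longrightarrow> q \<phi> = q \<psi>"
  using luk_derivable derivable_con_iff by (auto simp: q_eq_iff)

lemma mfm_quotient_simps:
  "carrier (mfm_quotient q) = range q" "\<one>\<^bsub>mfm_quotient q\<^esub> = q MOne" "\<zero>\<^bsub>mfm_quotient q\<^esub> = q MZero"
  "q \<phi> \<otimes>\<^bsub>mfm_quotient q\<^esub> q \<psi> = q (MFus \<phi> \<psi>)"
  "q \<phi> \<leadsto>\<^bsub>mfm_quotient q\<^esub> q \<psi> = q (MImp \<phi> \<psi>)"
  "q \<phi> \<curlywedge>\<^bsub>mfm_quotient q\<^esub> q \<psi> = q (MConj \<phi> \<psi>)"
  "q \<phi> \<curlyvee>\<^bsub>mfm_quotient q\<^esub> q \<psi> = q (MDisj \<phi> \<psi>)"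
  by (simp_all add: mfm_quotient_def q_inv_q)

lemma mfm_quotient_modal: "rl_modal (mfm_quotient q) b (q \<phi>) = q (Modal b \<phi>)"
  using le_inv_q [of \<phi>] by (auto simp: mfm_quotient_def q_eq_iff intro: modal_mono)

lemma mfm_quotient_neg: "rl_neg (mfm_quotient q) (q \<phi>) = q (MImp \<phi> MZero)"
  by (simp add: rl_neg_def mfm_quotient_simps)

lemma mfm_quotient_gbl: "gbl_algebra (mfm_quotient q)"
  and mfm_quotient_le: "q \<phi> \<preceq>\<^bsub>mfm_quotient q\<^esub> q \<psi> \<longleftrightarrow> modal_derives Ax \<Gamma> (MImp \<phi> \<psi>)"
  by (rule quotient_gbl; rule mfm_quotient_simps)+

lemma mfm_quotient_mv: "mv_algebra (mfm_quotient q)"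
proof (intro mv_algebra.intro mv_algebra_axioms.intro mfm_quotient_gbl)
  fix x y assume "x \<in> carrier (mfm_quotient q)" "y \<in> carrier (mfm_quotient q)"
  then obtain \<phi> \<psi> where xy: "x = q \<phi>" "y = q \<psi>" unfolding mfm_quotient_simps(1) by blast
  show "(x \<leadsto>\<^bsub>mfm_quotient q\<^esub> y) \<curlyvee>\<^bsub>mfm_quotient q\<^esub> (y \<leadsto>\<^bsub>mfm_quotient q\<^esub> x) = \<one>\<^bsub>mfm_quotient q\<^esub>"
    unfolding xy mfm_quotient_simps q_eq_one_iff by (intro luk_derivable luk_axioms.A14)
next
  fix x assume "x \<in> carrier (mfm_quotient q)"
  then obtain \<phi> where x: "x = q \<phi>" unfolding mfm_quotient_simps(1) by blast
  show "rl_neg (mfm_quotient q) (rl_neg (mfm_quotient q) x) = x"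
    unfolding x mfm_quotient_neg by (intro iff_derivable luk_axioms.A15)
qed

lemma mfm_quotient_endo: "rl_endo (mfm_quotient q) (rl_modal (mfm_quotient q) b)"
  unfolding rl_endo_def mfm_quotient_simps(1)
  by (auto simp: mfm_quotient_simps(2-) mfm_quotient_modal
      intro!: iff_derivable luk_axioms.M luk_axioms.P luk_axioms.Modal_one luk_axioms.Modal_zero)

lemma mfm_quotient_interior: "interior_op (mfm_quotient q) (rl_modal (mfm_quotient q) b)"
  unfolding interior_op_def mfm_quotient_simps(1)
  by (auto simp: mfm_quotient_modal mfm_quotient_le modal_mono q_eq_iff
      intro!: s4luk_derivable s4luk_axioms.T s4luk_axioms.Four)

lemma modal_eval_mfm_quotient: "modal_eval (mfm_quotient q) (\<lambda>p. q (MVar p)) \<phi> = q \<phi>"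
  by (induction \<phi>) (simp_all add: mfm_quotient_simps mfm_quotient_modal)

lemma derivable_of_modal_eq_conseq:
  assumes L: "modal_eq_conseq K {(f \<psi>, MOne) |\<psi>. \<psi> \<in> \<Delta>} (\<phi>, MOne)"
    and "mfm_quotient q \<in> K" "\<Gamma> = f ` \<Delta>"
  shows "modal_derives Ax \<Gamma> \<phi>"
proof -
  have "range (\<lambda>p. q (MVar p)) \<subseteq> range q" by blast
  moreover have "modal_derives Ax \<Gamma> (f \<psi>)" if "\<psi> \<in> \<Delta>" for \<psi>
    using that assms(3) by (auto intro: modal_derives.premise)
  ultimately have "modal_eval (mfm_quotient q) (\<lambda>p. q (MVar p)) \<phi> = \<one>\<^bsub>mfm_quotient q\<^esub>"
    using L [unfolded modal_eq_conseq_one_iff, rule_format, OF assms(2), of "\<lambda>p. q (MVar p)"]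
    by (simp add: mfm_quotient_simps(1,2) modal_eval_mfm_quotient q_eq_one_iff)
  then show ?thesis by (simp only: modal_eval_mfm_quotient mfm_quotient_simps q_eq_one_iff)
qed

end

instance box :: countable
  by countable_datatype

instance tense :: countable
  by countable_datatype

instance mfm :: (countable) countable
  by countable_datatype

lemma ex_modal_lindenbaum:
  fixes Ax \<Gamma> :: "'i::countable mfm set"
  assumes "infinite (UNIV :: 'a set)" "s4luk_axioms \<subseteq> Ax"
  shows "\<exists>q :: 'i mfm \<Rightarrow> 'a. modal_lindenbaum Ax \<Gamma> q"
proof -
  have "luk_axioms \<subseteq> Ax" using assms(2) by (auto intro: s4luk_axioms.luk)
  then interpret H: hilbert_gbl "modal_derives Ax \<Gamma>" MZero MOne MConj MDisj MFus MImp
    by (rule hilbert_gbl_mfm)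
  obtain q :: "'i mfm \<Rightarrow> 'a" where
    "\<forall>x y. q x = q y \<longleftrightarrow> modal_derives Ax \<Gamma> (MImp x y) \<and> modal_derives Ax \<Gamma> (MImp y x)"
    using ex_quotient_map [OF assms(1) H.equivp_equivalent] by blast
  then have "modal_lindenbaum Ax \<Gamma> q" by unfold_locales (use assms(2) in auto)
  then show ?thesis by blast
qed

lemma s4luk_complete:
  assumes "infinite (UNIV :: 'b set)"
  shows "modal_eq_conseq (S4MV :: ('b, box) modal_rl set) {(f \<psi>, MOne) |\<psi>. \<psi> \<in> \<Delta>} (\<phi>, MOne)
    \<longleftrightarrow> f ` \<Delta> \<turnstile>\<^sub>S\<^sub>4\<^sub>L \<phi>"
proof
  assume L: "modal_eq_conseq (S4MV :: ('b, box) modal_rl set) {(f \<psi>, MOne) |\<psi>. \<psi> \<in> \<Delta>} (\<phi>, MOne)"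
  obtain q :: "box mfm \<Rightarrow> 'b" where "modal_lindenbaum s4luk_axioms (f ` \<Delta>) q"
    using ex_modal_lindenbaum [OF assms order_refl] by blast
  then interpret modal_lindenbaum s4luk_axioms "f ` \<Delta>" q .
  show "f ` \<Delta> \<turnstile>\<^sub>S\<^sub>4\<^sub>L \<phi>" unfolding s4luk_derives_def
    by (rule derivable_of_modal_eq_conseq [OF L])
      (simp_all add: S4MV_def mfm_quotient_mv mfm_quotient_endo mfm_quotient_interior)
next
  assume D: "f ` \<Delta> \<turnstile>\<^sub>S\<^sub>4\<^sub>L \<phi>"
  show "modal_eq_conseq (S4MV :: ('b, box) modal_rl set) {(f \<psi>, MOne) |\<psi>. \<psi> \<in> \<Delta>} (\<phi>, MOne)"
    unfolding modal_eq_conseq_one_iff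
  proof (intro ballI allI impI)
    fix A :: "('b, box) modal_rl" and v
    assume A: "A \<in> S4MV" and v: "range v \<subseteq> carrier A"
      and prem: "\<forall>\<psi>\<in>\<Delta>. modal_eval A v (f \<psi>) = \<one>\<^bsub>A\<^esub>"
    show "modal_eval A v \<phi> = \<one>\<^bsub>A\<^esub>"
      by (rule modal_sound [OF S4MV_D(1,2) [OF A] v _ _ D [unfolded s4luk_derives_def]])
        (use prem in \<open>auto intro: s4luk_axioms_valid [OF S4MV_D [OF A] v]\<close>)
  qed
qed

text \<open>GP is the unit of the adjunction and gives the direction from right to left. HF at the
  negation of \<open>y\<close>, contraposed, is the counit and gives the other one.\<close>

lemma (in modal_lindenbaum) mfm_quotient_adjunction:
  fixes G H :: 'i
  assumes GP: "\<And>\<phi>. modal_derives Ax \<Gamma> (MImp \<phi> (Modal G (MImp (Modal H (MImp \<phi> MZero)) MZero)))"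
    and HF: "\<And>\<phi>. modal_derives Ax \<Gamma> (MImp \<phi> (Modal H (MImp (Modal G (MImp \<phi> MZero)) MZero)))"
    and "x \<in> carrier (mfm_quotient q)" "y \<in> carrier (mfm_quotient q)"
  shows "x \<preceq>\<^bsub>mfm_quotient q\<^esub> rl_modal (mfm_quotient q) G y \<longleftrightarrow>
    rl_neg (mfm_quotient q) (rl_modal (mfm_quotient q) H (rl_neg (mfm_quotient q) x)) \<preceq>\<^bsub>mfm_quotient q\<^esub> y"
proof -
  let ?A = "mfm_quotient q"
  let ?n = "rl_neg ?A" and ?g = "rl_modal ?A G" and ?h = "rl_modal ?A H"
  interpret A: mv_algebra ?A by (rule mfm_quotient_mv)
  note g = rl_endoD(1) [OF mfm_quotient_endo] interior_opD(3) [OF mfm_quotient_interior]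
  have gp: "z \<preceq>\<^bsub>?A\<^esub> ?g (?n (?h (?n z)))" and hf: "z \<preceq>\<^bsub>?A\<^esub> ?h (?n (?g (?n z)))"
    if "z \<in> carrier ?A" for z
    using that unfolding mfm_quotient_simps(1)
    by (auto simp: mfm_quotient_neg mfm_quotient_modal mfm_quotient_le GP HF)
  note [simp] = assms(3,4) g(1)
  show ?thesis
  proof
    assume "x \<preceq>\<^bsub>?A\<^esub> ?g y"
    then have "?n (?g y) \<preceq>\<^bsub>?A\<^esub> ?n x" by (rule A.neg_antimono) simp_all
    then have hn: "?h (?n (?g y)) \<preceq>\<^bsub>?A\<^esub> ?h (?n x)" by (rule g(2)) simp_all
    have "?n y \<preceq>\<^bsub>?A\<^esub> ?h (?n (?g y))" using hf [of "?n y"] by (simp add: A.involution)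
    from this hn have "?n y \<preceq>\<^bsub>?A\<^esub> ?h (?n x)" by (rule A.rl_le_trans) simp_all
    then show "?n (?h (?n x)) \<preceq>\<^bsub>?A\<^esub> y" by (rule A.neg_le_swap) simp_all
  next
    assume "?n (?h (?n x)) \<preceq>\<^bsub>?A\<^esub> y"
    then have "?g (?n (?h (?n x))) \<preceq>\<^bsub>?A\<^esub> ?g y" by (rule g(2)) simp_all
    with gp [OF assms(3)] show "x \<preceq>\<^bsub>?A\<^esub> ?g y" by (rule A.rl_le_trans) simp_all
  qed
qed

lemma s4tluk_complete:
  assumes "infinite (UNIV :: 'c set)"
  shows "modal_eq_conseq (S4tMV :: ('c, tense) modal_rl set) {(f \<psi>, MOne) |\<psi>. \<psi> \<in> \<Delta>} (\<phi>, MOne)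
    \<longleftrightarrow> f ` \<Delta> \<turnstile>\<^sub>S\<^sub>4\<^sub>t\<^sub>L \<phi>"
proof
  assume L: "modal_eq_conseq (S4tMV :: ('c, tense) modal_rl set) {(f \<psi>, MOne) |\<psi>. \<psi> \<in> \<Delta>} (\<phi>, MOne)"
  have "s4luk_axioms \<subseteq> s4tluk_axioms" by (auto intro: s4tluk_axioms.s4luk)
  then obtain q :: "tense mfm \<Rightarrow> 'c" where "modal_lindenbaum s4tluk_axioms (f ` \<Delta>) q"
    using ex_modal_lindenbaum [OF assms] by blast
  then interpret modal_lindenbaum s4tluk_axioms "f ` \<Delta>" q .
  show "f ` \<Delta> \<turnstile>\<^sub>S\<^sub>4\<^sub>t\<^sub>L \<phi>" unfolding s4tluk_derives_def
  proof (rule derivable_of_modal_eq_conseq [OF L])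
    show "mfm_quotient q \<in> S4tMV" unfolding S4tMV_def
      by (auto simp: mfm_quotient_mv mfm_quotient_endo mfm_quotient_interior
          mfm_quotient_adjunction modal_derives.axiom s4tluk_axioms.GP s4tluk_axioms.HF)
  qed simp
next
  assume D: "f ` \<Delta> \<turnstile>\<^sub>S\<^sub>4\<^sub>t\<^sub>L \<phi>"
  show "modal_eq_conseq (S4tMV :: ('c, tense) modal_rl set) {(f \<psi>, MOne) |\<psi>. \<psi> \<in> \<Delta>} (\<phi>, MOne)"
    unfolding modal_eq_conseq_one_iff
  proof (intro ballI allI impI)
    fix A :: "('c, tense) modal_rl" and v
    assume A: "A \<in> S4tMV" and v: "range v \<subseteq> carrier A"
      and prem: "\<forall>\<psi>\<in>\<Delta>. modal_eval A v (f \<psi>) = \<one>\<^bsub>A\<^esub>"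
    show "modal_eval A v \<phi> = \<one>\<^bsub>A\<^esub>"
      by (rule modal_sound [OF S4tMV_D(1,2) [OF A] v _ _ D [unfolded s4tluk_derives_def]])
        (use prem in \<open>auto intro: s4tluk_axioms_valid [OF A v]\<close>)
  qed
qed


section \<open>Products of MV-algebras over a transitive relation\<close>

definition tense_rel :: "('k \<Rightarrow> 'k \<Rightarrow> bool) \<Rightarrow> tense \<Rightarrow> 'k \<Rightarrow> 'k \<Rightarrow> bool" where
  "tense_rel R b i j = (case b of G_op \<Rightarrow> R i j | H_op \<Rightarrow> R j i)"

text \<open>For a strict order \<open>R\<close>, the fixed points of \<open>G_op\<close> form the poset product of the algebras
  \<open>M i\<close>.\<close>

definition tense_product :: "'k set \<Rightarrow> ('k \<Rightarrow> 'x rl) \<Rightarrow> ('k \<Rightarrow> 'k \<Rightarrow> bool) \<Rightarrow> ('k \<Rightarrow> 'x, tense) modal_rl" where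
  "tense_product I M R = \<lparr>
    carrier = PiE I (\<lambda>i. carrier (M i)),
    mult = (\<lambda>x y. \<lambda>i\<in>I. x i \<otimes>\<^bsub>M i\<^esub> y i),
    one = (\<lambda>i\<in>I. \<one>\<^bsub>M i\<^esub>),
    rl_meet = (\<lambda>x y. \<lambda>i\<in>I. x i \<curlywedge>\<^bsub>M i\<^esub> y i),
    rl_join = (\<lambda>x y. \<lambda>i\<in>I. x i \<curlyvee>\<^bsub>M i\<^esub> y i),
    rl_imp = (\<lambda>x y. \<lambda>i\<in>I. x i \<leadsto>\<^bsub>M i\<^esub> y i),
    rl_zero = (\<lambda>i\<in>I. \<zero>\<^bsub>M i\<^esub>),
    rl_modal = (\<lambda>b x. \<lambda>i\<in>I.
      if \<forall>j\<in>I. tense_rel R b i j \<longrightarrow> x j = \<one>\<^bsub>M j\<^esub> then x i else \<zero>\<^bsub>M i\<^esub>)\<rparr>"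

context
  fixes I :: "'k set" and M :: "'k \<Rightarrow> 'x rl" and R :: "'k \<Rightarrow> 'k \<Rightarrow> bool"
  assumes mv: "\<And>i. i \<in> I \<Longrightarrow> mv_algebra (M i)"
begin

private abbreviation "P \<equiv> tense_product I M R"

lemma tense_product_gbl_component: "i \<in> I \<Longrightarrow> gbl_algebra (M i)"
  using mv by (simp add: mv_algebra_def)

lemma tense_product_rl_component: "i \<in> I \<Longrightarrow> bounded_ci_residuated_lattice (M i)"
  using tense_product_gbl_component by (simp add: gbl_algebra_def)

lemmas component_closed =
  bounded_ci_residuated_lattice.meet_closed [OF tense_product_rl_component]
  bounded_ci_residuated_lattice.join_closed [OF tense_product_rl_component]
  bounded_ci_residuated_lattice.imp_closed [OF tense_product_rl_component]
  bounded_ci_residuated_lattice.zero_closed [OF tense_product_rl_component]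

lemma component_monoid: "i \<in> I \<Longrightarrow> comm_monoid (M i)"
  using tense_product_rl_component by (simp add: bounded_ci_residuated_lattice_def)

lemma component_monoid_weak: "i \<in> I \<Longrightarrow> monoid (M i)"
  using component_monoid by (simp add: comm_monoid_def)

lemma tense_product_mem: "x \<in> carrier P \<Longrightarrow> i \<in> I \<Longrightarrow> x i \<in> carrier (M i)"
  by (auto simp: tense_product_def)

lemma tense_product_ext:
  "x \<in> carrier P \<Longrightarrow> y \<in> carrier P \<Longrightarrow> (\<And>i. i \<in> I \<Longrightarrow> x i = y i) \<Longrightarrow> x = y"
  by (auto simp: tense_product_def intro: PiE_ext)

lemma tense_product_le:
  assumes "x \<in> carrier P" "y \<in> carrier P"
  shows "x \<preceq>\<^bsub>P\<^esub> y \<longleftrightarrow> (\<forall>i\<in>I. x i \<preceq>\<^bsub>M i\<^esub> y i)"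
proof
  assume "x \<preceq>\<^bsub>P\<^esub> y"
  then have eq: "(\<lambda>i\<in>I. x i \<curlywedge>\<^bsub>M i\<^esub> y i) = x" by (simp add: rl_le_def tense_product_def)
  show "\<forall>i\<in>I. x i \<preceq>\<^bsub>M i\<^esub> y i"
  proof
    fix i assume "i \<in> I"
    then show "x i \<preceq>\<^bsub>M i\<^esub> y i" using fun_cong [OF eq, of i] by (simp add: rl_le_def)
  qed
next
  assume "\<forall>i\<in>I. x i \<preceq>\<^bsub>M i\<^esub> y i"
  then have "(\<lambda>i\<in>I. x i \<curlywedge>\<^bsub>M i\<^esub> y i) = x"
    using assms by (auto simp: tense_product_def rl_le_def PiE_iff extensional_def fun_eq_iff)
  then show "x \<preceq>\<^bsub>P\<^esub> y" by (simp add: rl_le_def tense_product_def)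
qed

lemma tense_product_closed:
  "x \<in> carrier P \<Longrightarrow> y \<in> carrier P \<Longrightarrow> x \<otimes>\<^bsub>P\<^esub> y \<in> carrier P"
  "x \<in> carrier P \<Longrightarrow> y \<in> carrier P \<Longrightarrow> x \<curlywedge>\<^bsub>P\<^esub> y \<in> carrier P"
  "x \<in> carrier P \<Longrightarrow> y \<in> carrier P \<Longrightarrow> x \<curlyvee>\<^bsub>P\<^esub> y \<in> carrier P"
  "x \<in> carrier P \<Longrightarrow> y \<in> carrier P \<Longrightarrow> x \<leadsto>\<^bsub>P\<^esub> y \<in> carrier P"
  "\<one>\<^bsub>P\<^esub> \<in> carrier P" "\<zero>\<^bsub>P\<^esub> \<in> carrier P"
  "x \<in> carrier P \<Longrightarrow> rl_modal P b x \<in> carrier P"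
  using component_closed monoid.m_closed [OF component_monoid_weak] monoid.one_closed [OF component_monoid_weak]
  by (auto simp: tense_product_def PiE_iff)

lemma tense_product_apply:
  assumes "i \<in> I"
  shows "(x \<otimes>\<^bsub>P\<^esub> y) i = x i \<otimes>\<^bsub>M i\<^esub> y i" "(x \<curlywedge>\<^bsub>P\<^esub> y) i = x i \<curlywedge>\<^bsub>M i\<^esub> y i"
    "(x \<curlyvee>\<^bsub>P\<^esub> y) i = x i \<curlyvee>\<^bsub>M i\<^esub> y i" "(x \<leadsto>\<^bsub>P\<^esub> y) i = x i \<leadsto>\<^bsub>M i\<^esub> y i"
    "\<one>\<^bsub>P\<^esub> i = \<one>\<^bsub>M i\<^esub>" "\<zero>\<^bsub>P\<^esub> i = \<zero>\<^bsub>M i\<^esub>"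
    "rl_modal P b x i = (if \<forall>j\<in>I. tense_rel R b i j \<longrightarrow> x j = \<one>\<^bsub>M j\<^esub> then x i else \<zero>\<^bsub>M i\<^esub>)"
  using assms by (simp_all add: tense_product_def)

lemma tense_product_neg_apply: "i \<in> I \<Longrightarrow> rl_neg P x i = rl_neg (M i) (x i)"
  by (simp add: rl_neg_def tense_product_apply)

lemma tense_product_mv: "mv_algebra P"
proof -
  note c = tense_product_closed and a = tense_product_apply and m = tense_product_mem
    and ext = tense_product_ext
  have "gbl_algebra P"
  proof (rule gbl_algebraI [of _ "\<lambda>x y. \<forall>i\<in>I. x i \<preceq>\<^bsub>M i\<^esub> y i"], goal_cases)
    case (7 x) then show ?case
      by (auto intro!: bounded_ci_residuated_lattice.rl_le_refl [OF tense_product_rl_component] m)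
  next
    case (8 x y z) then show ?case
      by (auto intro: bounded_ci_residuated_lattice.rl_le_trans [OF tense_product_rl_component, of _ "x _" "y _"] m)
  next
    case (9 x y) then show ?case
      by (intro ext) (auto intro!: bounded_ci_residuated_lattice.rl_le_antisym [OF tense_product_rl_component] simp: m)
  next
    case 10 then show ?case
      by (auto simp: a intro!: bounded_ci_residuated_lattice.meet_le1 [OF tense_product_rl_component] m)
  next
    case 11 then show ?case
      by (auto simp: a intro!: bounded_ci_residuated_lattice.meet_le2 [OF tense_product_rl_component] m)
  next
    case 12 then show ?case
      by (auto simp: a intro!: bounded_ci_residuated_lattice.meet_greatest [OF tense_product_rl_component] m)
  next
    case 13 then show ?case
      by (auto simp: a intro!: bounded_ci_residuated_lattice.join_ge1 [OF tense_product_rl_component] m)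
  next
    case 14 then show ?case
      by (auto simp: a intro!: bounded_ci_residuated_lattice.join_ge2 [OF tense_product_rl_component] m)
  next
    case 15 then show ?case
      by (auto simp: a intro!: bounded_ci_residuated_lattice.join_least [OF tense_product_rl_component] m)
  next
    case 16 then show ?case
      by (auto simp: a intro!: bounded_ci_residuated_lattice.zero_least [OF tense_product_rl_component] m)
  next
    case 17 then show ?case
      by (auto simp: a intro!: bounded_ci_residuated_lattice.one_greatest [OF tense_product_rl_component] m)
  next
    case 18 then show ?case
      by (intro ext c) (auto simp: a intro!: monoid.m_assoc [OF component_monoid_weak] m)
  next
    case 19 then show ?case
      by (intro ext c) (auto simp: a intro!: comm_monoid.m_comm [OF component_monoid] m)
  next
    case 20 then show ?case
      by (intro ext c) (auto simp: a intro!: monoid.l_one [OF component_monoid_weak] m)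
  next
    case 21 then show ?case
      by (simp add: a m bounded_ci_residuated_lattice.residuation [OF tense_product_rl_component])
  next
    case 22 then show ?case
      by (intro ext c) (auto simp: a intro!: gbl_algebra.divisibility [OF tense_product_gbl_component] m)
  qed (simp_all add: c)
  moreover have "mv_algebra_axioms P"
  proof
    fix x y assume "x \<in> carrier P" "y \<in> carrier P"
    then show "(x \<leadsto>\<^bsub>P\<^esub> y) \<curlyvee>\<^bsub>P\<^esub> (y \<leadsto>\<^bsub>P\<^esub> x) = \<one>\<^bsub>P\<^esub>"
      by (intro ext c) (auto simp: a intro!: mv_algebra.prelinearity [OF mv] m)
  next
    fix x assume x: "x \<in> carrier P"
    then have "rl_neg P (rl_neg P x) \<in> carrier P" by (simp add: rl_neg_def c)
    then show "rl_neg P (rl_neg P x) = x" using x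
      by (intro ext) (auto simp: tense_product_neg_apply intro!: mv_algebra.involution [OF mv] m)
  qed
  ultimately show ?thesis by (rule mv_algebra.intro)
qed

text \<open>Integrality makes the condition "all related components are 1" for a meet or product the
  conjunction of the conditions for its factors. This is why the operators are
  endomorphisms.\<close>

lemma component_meet_eq_one_iff:
  assumes "i \<in> I" "x \<in> carrier (M i)" "y \<in> carrier (M i)"
  shows "x \<curlywedge>\<^bsub>M i\<^esub> y = \<one>\<^bsub>M i\<^esub> \<longleftrightarrow> x = \<one>\<^bsub>M i\<^esub> \<and> y = \<one>\<^bsub>M i\<^esub>"
    and "x \<otimes>\<^bsub>M i\<^esub> y = \<one>\<^bsub>M i\<^esub> \<longleftrightarrow> x = \<one>\<^bsub>M i\<^esub> \<and> y = \<one>\<^bsub>M i\<^esub>"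
proof -
  interpret mv_algebra "M i" by (rule mv) fact
  show "x \<curlywedge>\<^bsub>M i\<^esub> y = \<one>\<^bsub>M i\<^esub> \<longleftrightarrow> x = \<one>\<^bsub>M i\<^esub> \<and> y = \<one>\<^bsub>M i\<^esub>" (is "?L \<longleftrightarrow> ?R")
  proof
    assume ?L
    then have "\<one>\<^bsub>M i\<^esub> \<preceq>\<^bsub>M i\<^esub> x" "\<one>\<^bsub>M i\<^esub> \<preceq>\<^bsub>M i\<^esub> y"
      using meet_le1 [OF assms(2,3)] meet_le2 [OF assms(2,3)] by metis+
    then show ?R using assms by (simp add: one_rl_le_iff)
  qed simp
  show "x \<otimes>\<^bsub>M i\<^esub> y = \<one>\<^bsub>M i\<^esub> \<longleftrightarrow> x = \<one>\<^bsub>M i\<^esub> \<and> y = \<one>\<^bsub>M i\<^esub>" (is "?L \<longleftrightarrow> ?R")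
  proof
    assume ?L
    then have "\<one>\<^bsub>M i\<^esub> \<preceq>\<^bsub>M i\<^esub> x" "\<one>\<^bsub>M i\<^esub> \<preceq>\<^bsub>M i\<^esub> y"
      using mult_le1 [OF assms(2,3)] mult_le2 [OF assms(2,3)] by metis+
    then show ?R using assms by (simp add: one_rl_le_iff)
  qed simp
qed

lemma component_bounds:
  assumes "i \<in> I" "x \<in> carrier (M i)"
  shows "\<zero>\<^bsub>M i\<^esub> \<curlywedge>\<^bsub>M i\<^esub> x = \<zero>\<^bsub>M i\<^esub>" "x \<curlywedge>\<^bsub>M i\<^esub> \<zero>\<^bsub>M i\<^esub> = \<zero>\<^bsub>M i\<^esub>"
    "\<zero>\<^bsub>M i\<^esub> \<otimes>\<^bsub>M i\<^esub> x = \<zero>\<^bsub>M i\<^esub>" "x \<otimes>\<^bsub>M i\<^esub> \<zero>\<^bsub>M i\<^esub> = \<zero>\<^bsub>M i\<^esub>"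
    "\<zero>\<^bsub>M i\<^esub> \<preceq>\<^bsub>M i\<^esub> x" "x \<preceq>\<^bsub>M i\<^esub> \<one>\<^bsub>M i\<^esub>" "x \<preceq>\<^bsub>M i\<^esub> x"
    "x \<preceq>\<^bsub>M i\<^esub> \<zero>\<^bsub>M i\<^esub> \<longleftrightarrow> x = \<zero>\<^bsub>M i\<^esub>" "\<one>\<^bsub>M i\<^esub> \<preceq>\<^bsub>M i\<^esub> x \<longleftrightarrow> x = \<one>\<^bsub>M i\<^esub>"
    "rl_neg (M i) x = \<one>\<^bsub>M i\<^esub> \<longleftrightarrow> x = \<zero>\<^bsub>M i\<^esub>"
    "rl_neg (M i) (rl_neg (M i) x) = x"
proof -
  interpret mv_algebra "M i" by (rule mv) fact
  note [simp] = assms(2)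
  show z: "x \<preceq>\<^bsub>M i\<^esub> \<zero>\<^bsub>M i\<^esub> \<longleftrightarrow> x = \<zero>\<^bsub>M i\<^esub>"
    using zero_least [of x] rl_le_antisym [of x "\<zero>\<^bsub>M i\<^esub>"] by auto
  show 1: "\<zero>\<^bsub>M i\<^esub> \<curlywedge>\<^bsub>M i\<^esub> x = \<zero>\<^bsub>M i\<^esub>" using zero_least [of x] by (simp add: rl_le_def)
  then show "x \<curlywedge>\<^bsub>M i\<^esub> \<zero>\<^bsub>M i\<^esub> = \<zero>\<^bsub>M i\<^esub>" by (simp add: meet_comm)
  show 2: "\<zero>\<^bsub>M i\<^esub> \<otimes>\<^bsub>M i\<^esub> x = \<zero>\<^bsub>M i\<^esub>" by (rule rl_le_antisym) (auto intro: zero_least)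
  then show "x \<otimes>\<^bsub>M i\<^esub> \<zero>\<^bsub>M i\<^esub> = \<zero>\<^bsub>M i\<^esub>" by (simp add: m_comm)
  show "rl_neg (M i) x = \<one>\<^bsub>M i\<^esub> \<longleftrightarrow> x = \<zero>\<^bsub>M i\<^esub>" using z
    by (simp add: rl_neg_def flip: rl_le_iff_imp)
  show "\<zero>\<^bsub>M i\<^esub> \<preceq>\<^bsub>M i\<^esub> x" "x \<preceq>\<^bsub>M i\<^esub> \<one>\<^bsub>M i\<^esub>" "x \<preceq>\<^bsub>M i\<^esub> x"
    "\<one>\<^bsub>M i\<^esub> \<preceq>\<^bsub>M i\<^esub> x \<longleftrightarrow> x = \<one>\<^bsub>M i\<^esub>"
    "rl_neg (M i) (rl_neg (M i) x) = x"
    by (simp_all add: zero_least one_rl_le_iff rl_neg_def involution [unfolded rl_neg_def])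
qed

lemma component_neg_zero: "i \<in> I \<Longrightarrow> rl_neg (M i) \<zero>\<^bsub>M i\<^esub> = \<one>\<^bsub>M i\<^esub>"
  using component_bounds(10) [of i "\<zero>\<^bsub>M i\<^esub>"] component_closed(4) by simp

text \<open>By transitivity, a component at which the condition of the operator holds sees only
  components at which it holds too, and these are left unchanged; this gives idempotence. The
  adjunction is proved by reducing both sides to one condition.\<close>

lemma tense_product_S4tMV:
  assumes trans: "\<And>i j k. i \<in> I \<Longrightarrow> j \<in> I \<Longrightarrow> k \<in> I \<Longrightarrow> R i j \<Longrightarrow> R j k \<Longrightarrow> R i k"
  shows "P \<in> S4tMV"
proof -
  note c = tense_product_closed and a = tense_product_apply and m = tense_product_mem
    and ext = tense_product_ext
  have trans': "tense_rel R b i j \<Longrightarrow> tense_rel R b j k \<Longrightarrow> tense_rel R b i k"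
    if "i \<in> I" "j \<in> I" "k \<in> I" for b i j k
    using trans [OF that] trans [OF that(3,2,1)] by (cases b) (auto simp: tense_rel_def)
  interpret mv_algebra P by (rule tense_product_mv)
  have idem: "rl_modal P b (rl_modal P b x) = rl_modal P b x" if x: "x \<in> carrier P" for b x
  proof (intro ext c x)
    fix i assume i: "i \<in> I"
    have "rl_modal P b x j = \<one>\<^bsub>M j\<^esub>"
      if "\<forall>j\<in>I. tense_rel R b i j \<longrightarrow> x j = \<one>\<^bsub>M j\<^esub>" "j \<in> I" "tense_rel R b i j" for j
    proof -
      have "\<forall>k\<in>I. tense_rel R b j k \<longrightarrow> x k = \<one>\<^bsub>M k\<^esub>"
        using that(1) trans' [OF i that(2) _ that(3)] by blast
      then show ?thesis using that by (simp add: a)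
    qed
    then show "rl_modal P b (rl_modal P b x) i = rl_modal P b x i"
      using i by (auto simp: a)
  qed
  have mono: "rl_modal P b x \<preceq>\<^bsub>P\<^esub> rl_modal P b y"
    if x: "x \<in> carrier P" and y: "y \<in> carrier P" and le: "x \<preceq>\<^bsub>P\<^esub> y" for b x y
  proof -
    have le_i: "x i \<preceq>\<^bsub>M i\<^esub> y i" if "i \<in> I" for i using le x y that by (simp add: tense_product_le)
    have "y i = \<one>\<^bsub>M i\<^esub>" if "i \<in> I" "x i = \<one>\<^bsub>M i\<^esub>" for i
      using le_i [OF that(1)] that component_bounds(9) [OF that(1) m [OF y that(1)]] by simp
    then show ?thesis using x y le_i
      by (auto simp: tense_product_le c a component_bounds component_closed m)
  qed
  have endo: "rl_endo P (rl_modal P b)" for b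
    unfolding rl_endo_def
    by (intro conjI ballI ext c funcsetI)
      (auto simp: a m component_meet_eq_one_iff component_bounds monoid.one_closed [OF component_monoid_weak] component_closed)
  have int: "interior_op P (rl_modal P b)" for b
    unfolding interior_op_def
    by (auto simp: idem mono tense_product_le c a component_bounds component_closed m)
  have "x \<preceq>\<^bsub>P\<^esub> rl_modal P G_op y \<longleftrightarrow> rl_neg P (rl_modal P H_op (rl_neg P x)) \<preceq>\<^bsub>P\<^esub> y"
    if x: "x \<in> carrier P" and y: "y \<in> carrier P" for x y
  proof -
    \<comment> \<open>Where \<open>G\<close> replaces \<open>y i\<close> by 0, the inequality
      demands \<open>x i\<close> to be 0. Dually, \<not>H\<not> replaces \<open>x j\<close> by 1 as
      soon as some \<open>x i\<close> with \<open>R i j\<close> is nonzero, which demands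
      \<open>y j\<close> to be 1.\<close>
    have "x \<preceq>\<^bsub>P\<^esub> rl_modal P G_op y \<longleftrightarrow> (\<forall>i\<in>I. x i \<preceq>\<^bsub>M i\<^esub> y i) \<and>
        (\<forall>i\<in>I. \<forall>j\<in>I. R i j \<longrightarrow> x i = \<zero>\<^bsub>M i\<^esub> \<or> y j = \<one>\<^bsub>M j\<^esub>)"
      using x y by (auto simp: tense_product_le c a tense_rel_def component_bounds m)
    moreover have "rl_neg P (rl_modal P H_op (rl_neg P x)) \<preceq>\<^bsub>P\<^esub> y \<longleftrightarrow> (\<forall>i\<in>I. x i \<preceq>\<^bsub>M i\<^esub> y i) \<and>
        (\<forall>i\<in>I. \<forall>j\<in>I. R i j \<longrightarrow> x i = \<zero>\<^bsub>M i\<^esub> \<or> y j = \<one>\<^bsub>M j\<^esub>)"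
    proof -
      have "rl_neg P (rl_modal P H_op (rl_neg P x)) \<preceq>\<^bsub>P\<^esub> y \<longleftrightarrow>
          (\<forall>j\<in>I. if \<forall>i\<in>I. R i j \<longrightarrow> x i = \<zero>\<^bsub>M i\<^esub> then x j \<preceq>\<^bsub>M j\<^esub> y j else y j = \<one>\<^bsub>M j\<^esub>)"
        using x y by (simp add: tense_product_le c a tense_rel_def component_bounds component_neg_zero m
            tense_product_neg_apply if_distrib [of "rl_neg _"] if_distrib [of "\<lambda>t. t \<preceq>\<^bsub>_\<^esub> _"] cong: if_cong)
      \<comment> \<open>The second branch of the conditional thus implies the inequality of the
        first, which can be demanded of every component.\<close>
      moreover have "x j \<preceq>\<^bsub>M j\<^esub> y j" if "j \<in> I" "y j = \<one>\<^bsub>M j\<^esub>" for j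
        using that x by (simp add: component_bounds m)
      ultimately show ?thesis by (auto split: if_splits)
    qed
    ultimately show ?thesis by simp
  qed
  then show ?thesis using endo int tense_product_mv by (simp add: S4tMV_def)
qed

end


section \<open>The canonical embedding\<close>

definition theory_mv :: "fm set \<times> fm \<Rightarrow> (fm set \<times> bool) rl" where
  "theory_mv = (\<lambda>(T, \<chi>). si_gbl_algebra.top_mv (fm_quotient (fm_class T)) (fm_class T \<chi>))"

definition theory_val :: "fm \<Rightarrow> fm set \<times> fm \<Rightarrow> fm set \<times> bool" where
  "theory_val \<phi> = (\<lambda>(T, \<chi>). si_gbl_algebra.top_hom (fm_quotient (fm_class T)) (fm_class T \<chi>) (fm_class T \<phi>))"

definition theory_top :: "fm set \<times> fm \<Rightarrow> fm set" where
  "theory_top = (\<lambda>(T, \<chi>). {\<phi>. fm_class T \<phi> \<in>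
    si_gbl_algebra.top_comp (fm_quotient (fm_class T)) (fm_class T \<chi>)})"

context
  fixes T :: "fm set" and \<chi> :: fm
  assumes max: "maximal_avoiding \<chi> T"
begin

interpretation L: gbl_lindenbaum T "fm_class T"
  by (rule gbl_lindenbaum_fm_class)

interpretation S: si_gbl_algebra "fm_quotient (fm_class T)" "fm_class T \<chi>"
  by (rule si_fm_quotient [OF max])

private lemma fm_class_closed [simp]: "fm_class T \<phi> \<in> carrier (fm_quotient (fm_class T))"
  by (simp add: L.fm_quotient_simps)

lemmas theory_defs = theory_mv_def theory_val_def theory_top_def

lemma theory_mv: "mv_algebra (theory_mv (T, \<chi>))"
  by (simp add: theory_defs S.top_mv_mv)

lemma theory_val_closed: "theory_val \<phi> (T, \<chi>) \<in> carrier (theory_mv (T, \<chi>))"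
  by (simp add: theory_defs S.top_hom_closed)

lemma theory_val_hom:
  "theory_val Zero (T, \<chi>) = \<zero>\<^bsub>theory_mv (T, \<chi>)\<^esub>"
  "theory_val One (T, \<chi>) = \<one>\<^bsub>theory_mv (T, \<chi>)\<^esub>"
  "theory_val (Conj \<phi> \<psi>) (T, \<chi>) = theory_val \<phi> (T, \<chi>) \<curlywedge>\<^bsub>theory_mv (T, \<chi>)\<^esub> theory_val \<psi> (T, \<chi>)"
  "theory_val (Disj \<phi> \<psi>) (T, \<chi>) = theory_val \<phi> (T, \<chi>) \<curlyvee>\<^bsub>theory_mv (T, \<chi>)\<^esub> theory_val \<psi> (T, \<chi>)"
  "theory_val (Fus \<phi> \<psi>) (T, \<chi>) = theory_val \<phi> (T, \<chi>) \<otimes>\<^bsub>theory_mv (T, \<chi>)\<^esub> theory_val \<psi> (T, \<chi>)"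
  "Imp \<phi> \<psi> \<in> theory_top (T, \<chi>) \<Longrightarrow>
    theory_val (Imp \<phi> \<psi>) (T, \<chi>) = theory_val \<phi> (T, \<chi>) \<leadsto>\<^bsub>theory_mv (T, \<chi>)\<^esub> theory_val \<psi> (T, \<chi>)"
  by (simp_all add: theory_defs S.top_hom_zero S.top_hom_one S.top_hom_meet S.top_hom_join
      S.top_hom_mult S.top_hom_imp flip: L.fm_quotient_simps)

lemma theory_val_outside_top: "\<phi> \<notin> theory_top (T, \<chi>) \<Longrightarrow> theory_val \<phi> (T, \<chi>) = \<zero>\<^bsub>theory_mv (T, \<chi>)\<^esub>"
  by (simp add: theory_defs S.top_hom_def)

lemma theory_val_member:
  assumes "\<phi> \<in> T"
  shows "theory_val \<phi> (T, \<chi>) = \<one>\<^bsub>theory_mv (T, \<chi>)\<^esub>"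
proof -
  have "fm_class T \<phi> = \<one>\<^bsub>fm_quotient (fm_class T)\<^esub>"
    using assms by (simp add: L.fm_quotient_simps L.q_eq_one_iff gbl_derives.premise)
  then show ?thesis by (simp add: theory_defs S.top_hom_one)
qed

lemma theory_val_avoided: "theory_val \<chi> (T, \<chi>) \<noteq> \<one>\<^bsub>theory_mv (T, \<chi>)\<^esub>"
  by (simp add: theory_defs S.top_hom_c)

lemma avoided_in_theory_top: "\<chi> \<in> theory_top (T, \<chi>)"
  by (simp add: theory_defs S.c_top_comp)

text \<open>The top component is a filter, so its preimage is deductively closed. Hence a formula
  outside it is avoided by some maximal theory that contains it.\<close>

lemma theory_top_derives: "theory_top (T, \<chi>) \<turnstile>\<^sub>G\<^sub>B\<^sub>L \<phi> \<longleftrightarrow> \<phi> \<in> theory_top (T, \<chi>)"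
proof
  assume "theory_top (T, \<chi>) \<turnstile>\<^sub>G\<^sub>B\<^sub>L \<phi>"
  then show "\<phi> \<in> theory_top (T, \<chi>)"
  proof induction
    case (axiom \<phi>)
    then have "fm_class T \<phi> = \<one>\<^bsub>fm_quotient (fm_class T)\<^esub>"
      by (simp add: L.fm_quotient_simps L.q_eq_one_iff gbl_derives.axiom)
    then show ?case by (simp add: theory_defs)
  next
    case (MP \<phi> \<psi>)
    let ?Q = "fm_quotient (fm_class T)"
    have "fm_class T \<phi> \<otimes>\<^bsub>?Q\<^esub> (fm_class T \<phi> \<leadsto>\<^bsub>?Q\<^esub> fm_class T \<psi>) \<in> S.top_comp"
      using MP by (intro S.top_comp_mult) (simp_all add: theory_defs L.fm_quotient_simps)
    then have "fm_class T \<psi> \<in> S.top_comp"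
      by (rule S.top_comp_upward) simp_all
    then show ?case by (simp add: theory_defs)
  qed
qed (rule gbl_derives.premise)

lemma theory_subset_top: "T \<subseteq> theory_top (T, \<chi>)"
proof
  fix \<phi> assume "\<phi> \<in> T"
  then have "fm_class T \<phi> = \<one>\<^bsub>fm_quotient (fm_class T)\<^esub>"
    by (simp add: L.fm_quotient_simps L.q_eq_one_iff gbl_derives.premise)
  then show "\<phi> \<in> theory_top (T, \<chi>)" by (simp add: theory_defs)
qed

end

section \<open>The canonical algebra and its truth lemma\<close>

context
  fixes \<Gamma> :: "fm set"
begin

definition theory_index :: "(fm set \<times> fm) set" where
  "theory_index = {(T, \<chi>). \<Gamma> \<subseteq> T \<and> maximal_avoiding \<chi> T}"

text \<open>Inclusion of theories would be too large an order: the top component may have proper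
  nontrivial filters, so a theory above \<open>T\<close> need not contain the top filter of \<open>T\<close>.\<close>

definition canonical_alg :: "(fm set \<times> fm \<Rightarrow> fm set \<times> bool, tense) modal_rl" where
  "canonical_alg = tense_product theory_index theory_mv (\<lambda>i j. theory_top i \<subseteq> fst j)"

lemma theory_index_mv: "i \<in> theory_index \<Longrightarrow> mv_algebra (theory_mv i)"
  by (auto simp: theory_index_def theory_mv)

lemma theory_index_subset_top: "i \<in> theory_index \<Longrightarrow> fst i \<subseteq> theory_top i"
  using theory_subset_top by (cases i) (simp add: theory_index_def)

text \<open>Every theory is contained in its own top filter, so the inclusions of top filters in
  theories compose.\<close>

lemma canonical_S4tMV: "canonical_alg \<in> S4tMV"
  unfolding canonical_alg_def
  using theory_index_subset_top by (intro tense_product_S4tMV theory_index_mv) blast+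

definition canonical_val :: "fm \<Rightarrow> fm set \<times> fm \<Rightarrow> fm set \<times> bool" where
  "canonical_val \<phi> = restrict (theory_val \<phi>) theory_index"

lemma canonical_val_closed: "canonical_val \<phi> \<in> carrier canonical_alg"
  by (auto simp: canonical_val_def canonical_alg_def tense_product_def theory_index_def theory_val_closed)

lemma canonical_G_apply:
  "rl_modal canonical_alg G_op x =
    (\<lambda>i\<in>theory_index. if \<forall>j\<in>theory_index. theory_top i \<subseteq> fst j \<longrightarrow> x j = \<one>\<^bsub>theory_mv j\<^esub>
      then x i else \<zero>\<^bsub>theory_mv i\<^esub>)"
  by (simp add: canonical_alg_def tense_product_def tense_rel_def)

text \<open>A formula in the top filter at \<open>i\<close> belongs to every theory above
  \<open>i\<close> and has value 1 there; a formula outside already has value 0 at \<open>i\<close>.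
  In either case \<open>G\<close> changes nothing.\<close>

lemma canonical_val_open: "rl_modal canonical_alg G_op (canonical_val \<phi>) = canonical_val \<phi>"
proof -
  have "theory_val \<phi> j = \<one>\<^bsub>theory_mv j\<^esub>"
    if "\<phi> \<in> theory_top i" "j \<in> theory_index" "theory_top i \<subseteq> fst j" for i j
    using that by (auto simp: theory_index_def intro!: theory_val_member)
  moreover have "theory_val \<phi> i = \<zero>\<^bsub>theory_mv i\<^esub>" if "i \<in> theory_index" "\<phi> \<notin> theory_top i" for i
    using that by (auto simp: theory_index_def intro: theory_val_outside_top)
  ultimately have "theory_val \<phi> i = \<zero>\<^bsub>theory_mv i\<^esub>" if "i \<in> theory_index"
    "\<exists>j\<in>theory_index. theory_top i \<subseteq> fst j \<and> theory_val \<phi> j \<noteq> \<one>\<^bsub>theory_mv j\<^esub>" for i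
    using that by blast
  then show ?thesis
    unfolding canonical_G_apply canonical_val_def by (intro restrict_ext) simp
qed

text \<open>If the implication is in the top filter at \<open>i\<close>, it is a member of all
  theories above, where it is evaluated pointwise to 1; so \<open>G\<close> keeps the pointwise
  value at \<open>i\<close>, which is the right one. Otherwise \<open>G\<close> has to produce 0,
  and a theory above \<open>i\<close> must refute the pointwise implication.\<close>

lemma canonical_val_imp:
  "rl_modal canonical_alg G_op (canonical_val \<phi> \<leadsto>\<^bsub>canonical_alg\<^esub> canonical_val \<psi>) =
    canonical_val (Imp \<phi> \<psi>)"
proof
  let ?imp = "\<lambda>i. theory_val \<phi> i \<leadsto>\<^bsub>theory_mv i\<^esub> theory_val \<psi> i"
  have imp: "canonical_val \<phi> \<leadsto>\<^bsub>canonical_alg\<^esub> canonical_val \<psi> = restrict ?imp theory_index"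
    by (auto simp: canonical_alg_def tense_product_def canonical_val_def)
  fix i
  show "rl_modal canonical_alg G_op (canonical_val \<phi> \<leadsto>\<^bsub>canonical_alg\<^esub> canonical_val \<psi>) i =
      canonical_val (Imp \<phi> \<psi>) i"
  proof (cases "i \<in> theory_index")
    case i: True
    then obtain T \<chi> where T: "i = (T, \<chi>)" "\<Gamma> \<subseteq> T" "maximal_avoiding \<chi> T"
      by (auto simp: theory_index_def)
    show ?thesis
    proof (cases "Imp \<phi> \<psi> \<in> theory_top i")
      case True
      have "?imp j = \<one>\<^bsub>theory_mv j\<^esub>" if j: "j \<in> theory_index" "theory_top i \<subseteq> fst j" for j
      proof -
        obtain T' \<chi>' where T': "j = (T', \<chi>')" "maximal_avoiding \<chi>' T'"
          using j by (auto simp: theory_index_def)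
        have "Imp \<phi> \<psi> \<in> T'" using True j T' by auto
        then show ?thesis
          using theory_val_member [OF T'(2)] theory_val_hom(6) [OF T'(2)] theory_subset_top [OF T'(2)] T'(1)
          by (metis subsetD)
      qed
      then show ?thesis unfolding imp using True i theory_val_hom(6) [OF T(3)] T(1)
        by (simp add: canonical_G_apply canonical_val_def)
    next
      case False
      then have "\<not> theory_top i \<turnstile>\<^sub>G\<^sub>B\<^sub>L Imp \<phi> \<psi>" using theory_top_derives [OF T(3)] T(1) by simp
      then obtain T' where T': "theory_top i \<subseteq> T'" "maximal_avoiding (Imp \<phi> \<psi>) T'"
        using ex_maximal_avoiding by blast
      \<comment> \<open>Taking the implication itself as the avoided formula puts it into the top
        filter of \<open>?j\<close>, so the pointwise implication there has its value, which is not
        1.\<close>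
      let ?j = "(T', Imp \<phi> \<psi>)"
      have j: "?j \<in> theory_index" using T' T theory_subset_top [OF T(3)] by (auto simp: theory_index_def)
      have "?imp ?j \<noteq> \<one>\<^bsub>theory_mv ?j\<^esub>"
        using theory_val_avoided [OF T'(2)] theory_val_hom(6) [OF T'(2) avoided_in_theory_top [OF T'(2)]]
        by simp
      then have C: "(\<forall>j\<in>theory_index. theory_top i \<subseteq> fst j \<longrightarrow>
          restrict ?imp theory_index j = \<one>\<^bsub>theory_mv j\<^esub>) = False"
        using bexI [OF _ j] T'(1) restrict_apply' [OF j, of ?imp] by force
      have "canonical_val (Imp \<phi> \<psi>) i = \<zero>\<^bsub>theory_mv i\<^esub>"
        using False i theory_val_outside_top [OF T(3)] T(1) by (simp add: canonical_val_def)
      then show ?thesis unfolding imp canonical_G_apply restrict_apply' [OF i] C by simp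
    qed
  qed (simp add: canonical_G_apply canonical_val_def)
qed

lemma canonical_truth:
  "modal_eval canonical_alg (\<lambda>p. canonical_val (Var p)) (translate G_op \<phi>) = canonical_val \<phi>"
proof (induction \<phi>)
  case (Var p)
  then show ?case by (simp add: canonical_val_open)
next
  case (Imp \<phi> \<psi>)
  then show ?case by (simp add: canonical_val_imp)
qed (auto simp: canonical_alg_def tense_product_def canonical_val_def theory_index_def
    theory_val_hom fun_eq_iff restrict_def)

lemma canonical_val_premise: "\<psi> \<in> \<Gamma> \<Longrightarrow> canonical_val \<psi> = \<one>\<^bsub>canonical_alg\<^esub>"
  by (auto simp: canonical_val_def canonical_alg_def tense_product_def theory_index_def
      fun_eq_iff restrict_def intro: theory_val_member)

lemma canonical_val_not_one:
  assumes "\<not> \<Gamma> \<turnstile>\<^sub>G\<^sub>B\<^sub>L \<phi>"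
  shows "canonical_val \<phi> \<noteq> \<one>\<^bsub>canonical_alg\<^esub>"
proof
  assume eq: "canonical_val \<phi> = \<one>\<^bsub>canonical_alg\<^esub>"
  obtain T where T: "\<Gamma> \<subseteq> T" "maximal_avoiding \<phi> T" using ex_maximal_avoiding [OF assms] by blast
  then have "(T, \<phi>) \<in> theory_index" by (simp add: theory_index_def)
  then have "theory_val \<phi> (T, \<phi>) = \<one>\<^bsub>theory_mv (T, \<phi>)\<^esub>"
    using fun_cong [OF eq, of "(T, \<phi>)"]
    by (simp add: canonical_val_def canonical_alg_def tense_product_def)
  then show False using theory_val_avoided [OF T(2)] by simp
qed

end

section \<open>Faithfulness of both translations\<close>

definition G_reduct :: "('a, tense) modal_rl \<Rightarrow> ('a, box) modal_rl" where
  "G_reduct A = \<lparr>carrier = carrier A, mult = mult A, one = one A, rl_meet = rl_meet A,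
    rl_join = rl_join A, rl_imp = rl_imp A, rl_zero = rl_zero A, rl_modal = (\<lambda>_. rl_modal A G_op)\<rparr>"

lemma modal_eval_G_reduct:
  "modal_eval (G_reduct A) v (translate Box \<phi>) = modal_eval A v (translate G_op \<phi>)"
  by (induction \<phi>) (simp_all add: G_reduct_def)

lemma G_reduct_S4MV:
  assumes "A \<in> S4tMV"
  shows "G_reduct A \<in> S4MV"
proof -
  interpret mv_algebra A by (rule S4tMV_D(1) [OF assms])
  have "mv_algebra (G_reduct A)"
    by unfold_locales
      (auto simp: G_reduct_def m_assoc meet_assoc join_assoc meet_join_absorb join_meet_absorb
        divisibility prelinearity rl_le_def rl_neg_def residuation [unfolded rl_le_def]
        zero_least [unfolded rl_le_def] one_greatest [unfolded rl_le_def]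
        involution [unfolded rl_neg_def] intro: m_comm meet_comm join_comm)
  then show ?thesis using S4tMV_D(2,3) [OF assms, of G_op]
    by (simp add: S4MV_def rl_endo_def interior_op_def rl_le_def G_reduct_def)
qed

lemma gbl_derives_transM_iff: "\<Gamma> \<turnstile>\<^sub>G\<^sub>B\<^sub>L \<phi> \<longleftrightarrow> transM ` \<Gamma> \<turnstile>\<^sub>S\<^sub>4\<^sub>L transM \<phi>"
proof
  assume D: "\<Gamma> \<turnstile>\<^sub>G\<^sub>B\<^sub>L \<phi>"
  \<comment> \<open>The type \<open>nat\<close> stands for any infinite type; completeness over it
    returns the derivation.\<close>
  have "modal_eq_conseq (S4MV :: (nat, box) modal_rl set) {(transM \<psi>, MOne) |\<psi>. \<psi> \<in> \<Gamma>} (transM \<phi>, MOne)"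
    unfolding modal_eq_conseq_one_iff transM_def
    by (auto intro!: translation_sound [OF mv_algebra.axioms(1) [OF S4MV_D(1)] S4MV_D(2,3) _ _ D])
  then show "transM ` \<Gamma> \<turnstile>\<^sub>S\<^sub>4\<^sub>L transM \<phi>" by (simp add: s4luk_complete)
next
  assume D: "transM ` \<Gamma> \<turnstile>\<^sub>S\<^sub>4\<^sub>L transM \<phi>"
  let ?A = "canonical_alg \<Gamma>" and ?v = "\<lambda>p. canonical_val \<Gamma> (Var p)"
  have B: "G_reduct ?A \<in> S4MV" by (rule G_reduct_S4MV [OF canonical_S4tMV])
  have v: "range ?v \<subseteq> carrier (G_reduct ?A)" by (auto simp: G_reduct_def canonical_val_closed)
  have eval: "modal_eval (G_reduct ?A) ?v (transM \<psi>) = canonical_val \<Gamma> \<psi>" for \<psi>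
    by (simp add: transM_def modal_eval_G_reduct canonical_truth)
  have one: "\<one>\<^bsub>G_reduct ?A\<^esub> = \<one>\<^bsub>?A\<^esub>" by (simp add: G_reduct_def)
  have "modal_eval (G_reduct ?A) ?v (transM \<phi>) = \<one>\<^bsub>G_reduct ?A\<^esub>"
    by (rule modal_sound [OF S4MV_D(1,2) [OF B] v _ _ D [unfolded s4luk_derives_def]])
      (auto simp: eval one canonical_val_premise intro: s4luk_axioms_valid [OF S4MV_D [OF B] v, simplified one])
  then show "\<Gamma> \<turnstile>\<^sub>G\<^sub>B\<^sub>L \<phi>" using canonical_val_not_one by (auto simp: eval one)
qed

lemma gbl_derives_transT_iff: "\<Gamma> \<turnstile>\<^sub>G\<^sub>B\<^sub>L \<phi> \<longleftrightarrow> transT ` \<Gamma> \<turnstile>\<^sub>S\<^sub>4\<^sub>t\<^sub>L transT \<phi>"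
proof
  assume D: "\<Gamma> \<turnstile>\<^sub>G\<^sub>B\<^sub>L \<phi>"
  have "modal_eq_conseq (S4tMV :: (nat, tense) modal_rl set) {(transT \<psi>, MOne) |\<psi>. \<psi> \<in> \<Gamma>} (transT \<phi>, MOne)"
    unfolding modal_eq_conseq_one_iff transT_def
    by (auto intro!: translation_sound [OF mv_algebra.axioms(1) [OF S4tMV_D(1)] S4tMV_D(2,3) _ _ D])
  then show "transT ` \<Gamma> \<turnstile>\<^sub>S\<^sub>4\<^sub>t\<^sub>L transT \<phi>" by (simp add: s4tluk_complete)
next
  assume D: "transT ` \<Gamma> \<turnstile>\<^sub>S\<^sub>4\<^sub>t\<^sub>L transT \<phi>"
  let ?A = "canonical_alg \<Gamma>" and ?v = "\<lambda>p. canonical_val \<Gamma> (Var p)"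
  note A = canonical_S4tMV [of \<Gamma>]
  have v: "range ?v \<subseteq> carrier ?A" by (auto simp: canonical_val_closed)
  have eval: "modal_eval ?A ?v (transT \<psi>) = canonical_val \<Gamma> \<psi>" for \<psi>
    by (simp add: transT_def canonical_truth)
  have "modal_eval ?A ?v (transT \<phi>) = \<one>\<^bsub>?A\<^esub>"
    by (rule modal_sound [OF S4tMV_D(1,2) [OF A] v _ _ D [unfolded s4tluk_derives_def]])
      (auto simp: eval canonical_val_premise intro: s4tluk_axioms_valid [OF A v])
  then show "\<Gamma> \<turnstile>\<^sub>G\<^sub>B\<^sub>L \<phi>" using canonical_val_not_one by (auto simp: eval)
qed

theorem theorem4:
  fixes \<Gamma> :: "fm set" and \<phi> :: fm
  assumes "infinite (UNIV :: 'a set)"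
    and "infinite (UNIV :: 'b set)"
    and "infinite (UNIV :: 'c set)"
  shows "(eq_conseq (GBL :: 'a rl set) {(\<psi>, One) |\<psi>. \<psi> \<in> \<Gamma>} (\<phi>, One) \<longleftrightarrow>
          modal_eq_conseq (S4MV :: ('b, box) modal_rl set)
            {(transM \<psi>, MOne) |\<psi>. \<psi> \<in> \<Gamma>} (transM \<phi>, MOne))
       \<and> (\<Gamma> \<turnstile>\<^sub>G\<^sub>B\<^sub>L \<phi> \<longleftrightarrow> transM ` \<Gamma> \<turnstile>\<^sub>S\<^sub>4\<^sub>L transM \<phi>)
       \<and> (eq_conseq (GBL :: 'a rl set) {(\<psi>, One) |\<psi>. \<psi> \<in> \<Gamma>} (\<phi>, One) \<longleftrightarrow>
          modal_eq_conseq (S4tMV :: ('c, tense) modal_rl set)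
            {(transT \<psi>, MOne) |\<psi>. \<psi> \<in> \<Gamma>} (transT \<phi>, MOne))
       \<and> (\<Gamma> \<turnstile>\<^sub>G\<^sub>B\<^sub>L \<phi> \<longleftrightarrow> transT ` \<Gamma> \<turnstile>\<^sub>S\<^sub>4\<^sub>t\<^sub>L transT \<phi>)"
  using gbl_complete [OF assms(1), of \<Gamma> \<phi>] s4luk_complete [OF assms(2), of transM \<Gamma> "transM \<phi>"]
    s4tluk_complete [OF assms(3), of transT \<Gamma> "transT \<phi>"]
    gbl_derives_transM_iff [of \<Gamma> \<phi>] gbl_derives_transT_iff [of \<Gamma> \<phi>]
  by blast

end
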